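(* Let $Y^{\mathrm{id}}=X+\varepsilon$ be the ideal model and $\mathcal U$ the neighborhood of radius $r\in(0,1)$ described in the context, in which the distorted state is $X^{\mathrm{re}}=Y^{\mathrm{re}}-\varepsilon$. Put $\tilde D(y)=y-\mathrm E_{\mathrm{id}}[X\mid Y^{\mathrm{id}}=y]$. (1)' Consider the problem of finding a measurable $f$ minimizing $\max_{\mathcal U}\mathrm E_{\mathrm{re}}|X^{\mathrm{re}}-f(Y^{\mathrm{re}})|^2$. It has a saddle-point $(f_1,P_1^{Y^{\mathrm{di}}})$ given by $$f_1(y)=y-\tilde D(y)\min\{1,\tilde\rho/|\tilde D(y)|\},\qquad P_1^{Y^{\mathrm{di}}}(dy)=\frac{1-r}{r}\Big(\frac{|\tilde D(y)|}{\tilde\rho}-1\Big)_+P^{Y^{\mathrm{id}}}(dy),$$ where $\tilde\rho>0$ is such that $\int P_1^{Y^{\mathrm{di}}}(dy)=1$. (3)' If $\mathrm E_{\mathrm{id}}[X\mid Y]$ is linear in $Y=Y^{\mathrm{id}}$, i.e. $\mathrm E_{\mathrm{id}}[X\mid Y]=MY$ for some matrix $M$, then necessarily $$M=M^0=\operatorname{Cov}(X,Y)\,(\operatorname{Var}Y)^{-};$$ in the state space formulation $M^0$ is the classical Kalman gain and $f_1$ is the one-step rLS.IO filter, i.e. $f_1(y)=y-(y-M^0y)\min\{1,\tilde\rho/|y-M^0y|\}$.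
   Context: Ideal model: $X$ (state) and $\varepsilon$ (observation error) are independent random vectors in the same Euclidean space with finite second moments, $\mathrm E\varepsilon=0$, and $Y^{\mathrm{id}}=X+\varepsilon$; subscript "id" denotes evaluation in this model. Innovation-outlier version of the substitutive outlier model: $Y^{\mathrm{re}}=(1-U)Y^{\mathrm{id}}+UY^{\mathrm{di}}$ with $U\sim\mathrm{Bin}(1,r)$ independent of $(\varepsilon,Y^{\mathrm{id}})$ and of $(\varepsilon,Y^{\mathrm{di}})$, where $Y^{\mathrm{di}}$ is stochastically independent of $\varepsilon$ and its law $P^{Y^{\mathrm{di}}}$ is arbitrary. The error $\varepsilon$ stays ideally distributed and the replacement of $Y^{\mathrm{id}}$ by $Y^{\mathrm{di}}$ reflects a corresponding change in the state: $X^{\mathrm{re}}=Y^{\mathrm{re}}-\varepsilon$. For radius $s$ let $\partial\mathcal U(s)$ be the set of all joint laws $\mathcal L(\varepsilon,Y^{\mathrm{re}})$ (equivalently of $(X^{\mathrm{re}},Y^{\mathrm{re}})$) obtained with $U\sim\mathrm{Bin}(1,s)$, and $\mathcal U=\mathcal U(r)=\bigcup_{0\le s\le r}\partial\mathcal U(s)$. Saddle-point means: letting $P_1\in\partial\mathcal U(r)$ be the law generated by $P_1^{Y^{\mathrm{di}}}$, $\mathrm E_P|X^{\mathrm{re}}-f_1(Y^{\mathrm{re}})|^2\le\mathrm E_{P_1}|X^{\mathrm{re}}-f_1(Y^{\mathrm{re}})|^2\le\mathrm E_{P_1}|X^{\mathrm{re}}-f(Y^{\mathrm{re}})|^2$ for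 all $P\in\mathcal U$ and all measurable $f$. $A^-$ denotes the Moore–Penrose inverse, $(x)_+=\max(x,0)$, $|\cdot|$ the Euclidean norm, and $\min\{1,\tilde\rho/0\}=1$. In a state space model (with observation matrix the identity) $X$ is the centered prediction error, $Y$ the observation innovation, and the Kalman gain is $\Sigma(\Sigma+V)^-$ with $\Sigma=\operatorname{Cov}X$, $V=\operatorname{Cov}\varepsilon$.
   Formalization: M=M^0 is claimed only if Var Y is invertible, in general only on range(Var Y); MY=M^0Y a.s. and the rLS.IO form of f_1 (a.s.) are claimed if E X lies in range(Var Y), e.g. X centered; existence of rho is claimed unless epsilon=0 a.s. *)

theory Defs
  imports "HOL-Probability.Probability"
begin

subsection \<open>Matrices\<close>

definition moore_penrose_inverse :: "real^'n^'m \<Rightarrow> real^'m^'n" where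
  "moore_penrose_inverse A = (THE B.
     A ** B ** A = A \<and> B ** A ** B = B \<and>
     transpose (A ** B) = A ** B \<and> transpose (B ** A) = B ** A)"

definition cov_matrix :: "'a measure \<Rightarrow> ('a \<Rightarrow> real^'n) \<Rightarrow> ('a \<Rightarrow> real^'m) \<Rightarrow> real^'m^'n" where
  "cov_matrix M X Y = (\<chi> i j.
     (\<integral>\<omega>. (X \<omega> $ i - (\<integral>\<omega>'. X \<omega>' $ i \<partial>M)) * (Y \<omega> $ j - (\<integral>\<omega>'. Y \<omega>' $ j \<partial>M)) \<partial>M))"

abbreviation var_matrix :: "'a measure \<Rightarrow> ('a \<Rightarrow> real^'n) \<Rightarrow> real^'n^'n" where
  "var_matrix M X \<equiv> cov_matrix M X X"

subsection \<open>Probability\<close>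

text \<open>The constant \<^const>\<open>prob_space.indep_var\<close> forces both variables to take values in the same
  type; this is its description by generated sigma-algebras, for two different value types.\<close>

definition indep_rv ::
  "'w measure \<Rightarrow> 'b measure \<Rightarrow> ('w \<Rightarrow> 'b) \<Rightarrow> 'c measure \<Rightarrow> ('w \<Rightarrow> 'c) \<Rightarrow> bool" where
  "indep_rv N S A T B \<longleftrightarrow>
     A \<in> measurable N S \<and> B \<in> measurable N T \<and>
     prob_space.indep_set N (sets (vimage_algebra (space N) A S))
                            (sets (vimage_algebra (space N) B T))"

text \<open>\<open>m\<close> is a version of the function \<open>y \<mapsto> E[X | Y = y]\<close>. The library's conditional expectation is
  real valued, so that of a vector is taken coordinatewise.\<close>

definition cond_exp_given ::
  "'a measure \<Rightarrow> ('a \<Rightarrow> real^'n) \<Rightarrow> ('a \<Rightarrow> real^'n) \<Rightarrow> (real^'n \<Rightarrow> real^'n) \<Rightarrow> bool" where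
  "cond_exp_given M X Y m \<longleftrightarrow>
     m \<in> borel_measurable borel \<and>
     (\<forall>i. AE \<omega> in M.
        real_cond_exp M (vimage_algebra (space M) Y borel) (\<lambda>\<omega>. X \<omega> $ i) \<omega> = m (Y \<omega>) $ i)"

subsection \<open>The substitutive innovation-outlier model\<close>

definition y_re :: "('w \<Rightarrow> nat) \<Rightarrow> ('w \<Rightarrow> real^'n) \<Rightarrow> ('w \<Rightarrow> real^'n) \<Rightarrow> 'w \<Rightarrow> real^'n" where
  "y_re U Yid Ydi \<omega> = (1 - real (U \<omega>)) *\<^sub>R Yid \<omega> + real (U \<omega>) *\<^sub>R Ydi \<omega>"

text \<open>The ideal model is given by \<open>(X, eps)\<close> on \<open>M\<close>; \<open>(X', eps')\<close> is a copy of it on the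
  probability space \<open>N\<close> carrying the contamination. The joint law of \<open>Ydi\<close> with \<open>X'\<close>, and that of
  all variables together, remain otherwise unrestricted.\<close>

definition io_model ::
  "'a measure \<Rightarrow> ('a \<Rightarrow> real^'n) \<Rightarrow> ('a \<Rightarrow> real^'n) \<Rightarrow> real \<Rightarrow>
   'w measure \<Rightarrow> ('w \<Rightarrow> real^'n) \<Rightarrow> ('w \<Rightarrow> real^'n) \<Rightarrow> ('w \<Rightarrow> nat) \<Rightarrow> ('w \<Rightarrow> real^'n) \<Rightarrow> bool" where
  "io_model M X eps s N X' eps' U Ydi \<longleftrightarrow>
     prob_space N \<and>
     X' \<in> borel_measurable N \<and> eps' \<in> borel_measurable N \<and>
     distr N borel (\<lambda>\<omega>. (X' \<omega>, eps' \<omega>)) = distr M borel (\<lambda>\<omega>. (X \<omega>, eps \<omega>)) \<and>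
     U \<in> measurable N (count_space UNIV) \<and>
     distr N (count_space UNIV) U = measure_pmf (binomial_pmf 1 s) \<and>
     indep_rv N (count_space UNIV) U borel (\<lambda>\<omega>. (eps' \<omega>, X' \<omega> + eps' \<omega>)) \<and>
     indep_rv N (count_space UNIV) U borel (\<lambda>\<omega>. (eps' \<omega>, Ydi \<omega>)) \<and>
     prob_space.indep_var N borel eps' borel Ydi"

text \<open>\<open>P\<close> is a joint law of \<open>(eps, Yre)\<close> at radius \<open>s\<close> generated by the contaminating law \<open>G\<close>.
  Any realization on any probability space can be transported along \<open>(U, X, eps, Ydi)\<close> to the type
  of sample points used here, so fixing that type loses no laws.\<close>

definition io_law ::
  "'a measure \<Rightarrow> ('a \<Rightarrow> real^'n) \<Rightarrow> ('a \<Rightarrow> real^'n) \<Rightarrow> real \<Rightarrow>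
   (real^'n) measure \<Rightarrow> ((real^'n) \<times> (real^'n)) measure \<Rightarrow> bool" where
  "io_law M X eps s G P \<longleftrightarrow>
     (\<exists>(N :: (nat \<times> (real^'n) \<times> (real^'n) \<times> (real^'n)) measure) X' eps' U Ydi.
        io_model M X eps s N X' eps' U Ydi \<and>
        G = distr N borel Ydi \<and>
        P = distr N borel (\<lambda>\<omega>. (eps' \<omega>, y_re U (\<lambda>\<omega>. X' \<omega> + eps' \<omega>) Ydi \<omega>)))"

definition io_sphere ::
  "'a measure \<Rightarrow> ('a \<Rightarrow> real^'n) \<Rightarrow> ('a \<Rightarrow> real^'n) \<Rightarrow> real \<Rightarrow> ((real^'n) \<times> (real^'n)) measure set" where
  "io_sphere M X eps s = {P. \<exists>G. io_law M X eps s G P}"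

definition io_neighborhood ::
  "'a measure \<Rightarrow> ('a \<Rightarrow> real^'n) \<Rightarrow> ('a \<Rightarrow> real^'n) \<Rightarrow> real \<Rightarrow> ((real^'n) \<times> (real^'n)) measure set" where
  "io_neighborhood M X eps r = (\<Union>s\<in>{0..r}. io_sphere M X eps s)"

text \<open>Expected squared error for the state \<open>Xre = Yre - eps\<close>, where \<open>P\<close> is the law of
  \<open>(eps, Yre)\<close>. It may be infinite.\<close>

definition io_risk :: "((real^'n) \<times> (real^'n)) measure \<Rightarrow> (real^'n \<Rightarrow> real^'n) \<Rightarrow> ennreal" where
  "io_risk P f = (\<integral>\<^sup>+(e, y). ennreal ((norm ((y - e) - f y))\<^sup>2) \<partial>P)"

definition io_saddle_point ::
  "'a measure \<Rightarrow> ('a \<Rightarrow> real^'n) \<Rightarrow> ('a \<Rightarrow> real^'n) \<Rightarrow> real \<Rightarrow>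
   (real^'n \<Rightarrow> real^'n) \<Rightarrow> (real^'n) measure \<Rightarrow> bool" where
  "io_saddle_point M X eps r f1 G1 \<longleftrightarrow>
     f1 \<in> borel_measurable borel \<and>
     (\<exists>P1. io_law M X eps r G1 P1) \<and>
     (\<forall>P1. io_law M X eps r G1 P1 \<longrightarrow>
        (\<forall>P\<in>io_neighborhood M X eps r. io_risk P f1 \<le> io_risk P1 f1) \<and>
        (\<forall>f\<in>borel_measurable borel. io_risk P1 f1 \<le> io_risk P1 f))"

subsection \<open>The saddle-point\<close>

definition clip_factor :: "real \<Rightarrow> real^'n \<Rightarrow> real" where
  "clip_factor \<rho> d = (if d = 0 then 1 else min 1 (\<rho> / norm d))"

text \<open>In both definitions \<open>m\<close> stands for \<open>y \<mapsto> E[X | Y = y]\<close>, so that \<open>y - m y\<close> is the function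
  \<open>D\<close> being clipped.\<close>

definition rls_io :: "(real^'n \<Rightarrow> real^'n) \<Rightarrow> real \<Rightarrow> real^'n \<Rightarrow> real^'n" where
  "rls_io m \<rho> y = y - clip_factor \<rho> (y - m y) *\<^sub>R (y - m y)"

definition least_favorable ::
  "(real^'n) measure \<Rightarrow> (real^'n \<Rightarrow> real^'n) \<Rightarrow> real \<Rightarrow> real \<Rightarrow> (real^'n) measure" where
  "least_favorable Q m r \<rho> =
     density Q (\<lambda>y. ennreal ((1 - r) / r * max (norm (y - m y) / \<rho> - 1) 0))"

end

theory Submission
  imports Defs
begin

text \<open>Everything is expressed through the residual \<open>g y = y - f y\<close> of a procedure \<open>f\<close>. Since
\<open>Xre - f Yre = g Yre - eps\<close>, estimating the state is the same as estimating the error \<open>eps\<close> by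
\<open>g Yre\<close>, and \<open>D y = y - m y\<close> is the ideal Bayes estimate \<open>E[eps | Y = y]\<close> of that error.

The independence assumptions on \<open>U\<close> and \<open>Ydi\<close> determine the law of \<open>(eps, Yre)\<close>: at radius \<open>s\<close> and
with contaminating law \<open>G\<close> it is the mixture of the ideal law of \<open>(eps, Y)\<close>, with weight \<open>1 - s\<close>,
and the product of the law of \<open>eps\<close> with \<open>G\<close>, with weight \<open>s\<close> (lemma \<open>nn_integral_io_law\<close>). As
\<open>eps\<close> is centred, the risk of \<open>f\<close> is therefore
\<open>(1 - s) E|eps - g Y|^2 + s (E|eps|^2 + \<integral>|g|^2 dG)\<close> (lemma \<open>io_risk_eq\<close>).

The residual \<open>g1\<close> of the proposed procedure is \<open>D\<close> clipped at height \<open>\<rho>\<close>. The contamination enters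
only through \<open>\<integral>|g1|^2 dG \<le> \<rho>^2\<close>, with equality for the proposed \<open>G\<close>, which lives where
\<open>|D| > \<rho>\<close>. Full radius \<open>s = r\<close> is worst because by Pythagoras
(lemma \<open>nn_integral_pythagoras\<close>) \<open>E|eps - g1 Y|^2\<close> is at most \<open>E|eps|^2\<close>, the value of that
functional at the residual \<open>0\<close>, since \<open>g1\<close> is everywhere at least as close to \<open>D\<close> as \<open>0\<close> is. For the
optimality of \<open>g1\<close> at \<open>(r, G)\<close>, the density of \<open>G\<close> is chosen so that, after Pythagoras, the risk at \<open>(r, G)\<close>
is a constant plus \<open>1 - r\<close> times the expectation of \<open>|D - g|^2 + (|D|/\<rho> - 1)_+ |g|^2\<close>, and at every
point this quadratic in \<open>g\<close> is minimized by the clipped \<open>D\<close>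
(lemma \<open>clipped_minimizes_penalized_distance\<close>).

The normalizing \<open>\<rho>\<close> comes from the intermediate value theorem, unless \<open>D Y\<close> vanishes almost surely;
then \<open>E|eps|^2 = E[eps \<bullet> Y] = E[D Y \<bullet> Y] = 0\<close>.

If the conditional expectation is \<open>A *v Y\<close>, testing it against the coordinates of \<open>Y\<close> and against
\<open>1\<close> gives the normal equation \<open>A ** Var Y = Cov (X, Y)\<close>, so that \<open>A\<close> agrees with
\<open>M0 = Cov (X, Y) ** (Var Y)^-\<close> on the range of \<open>Var Y\<close>. The centred variable \<open>Y - E Y\<close> lies in
that range almost surely; if \<open>E X = E Y\<close> lies there too, so does \<open>Y\<close>, and \<open>A *v Y = M0 *v Y\<close>. The Kalman
form of \<open>M0\<close> holds because \<open>X\<close> and \<open>eps\<close> are uncorrelated.\<close>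

section \<open>The Moore-Penrose inverse of a symmetric matrix\<close>

text \<open>The usual argument: both \<open>A ** B\<close> and \<open>A ** C\<close> are the orthogonal projection onto the range of
\<open>A\<close>, and both \<open>B ** A\<close> and \<open>C ** A\<close> the one onto the range of the transpose.\<close>
lemma moore_penrose_unique:
  fixes A :: "real^'n^'m" and B C :: "real^'m^'n"
  assumes B: "A ** B ** A = A" "B ** A ** B = B"
      "transpose (A ** B) = A ** B" "transpose (B ** A) = B ** A"
    and C: "A ** C ** A = A" "C ** A ** C = C"
      "transpose (A ** C) = A ** C" "transpose (C ** A) = C ** A"
  shows "B = C"
proof -
  have "A ** B = (A ** C ** A) ** B" by (simp only: C(1))
  also have "\<dots> = transpose (A ** C) ** transpose (A ** B)"
    using B(3) C(3) by (simp add: matrix_mul_assoc)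
  also have "\<dots> = transpose ((A ** B ** A) ** C)"
    by (simp add: matrix_transpose_mul matrix_mul_assoc)
  finally have AB: "A ** B = A ** C" using B(1) C(3) by simp
  have "B ** A = B ** (A ** C ** A)" by (simp only: C(1))
  also have "\<dots> = transpose (B ** A) ** transpose (C ** A)"
    using B(4) C(4) by (simp add: matrix_mul_assoc)
  also have "\<dots> = transpose (C ** (A ** B ** A))"
    by (simp add: matrix_transpose_mul matrix_mul_assoc)
  finally have BA: "B ** A = C ** A" using B(1) C(4) by simp
  have "B = B ** (A ** B)" using B(2) by (simp add: matrix_mul_assoc)
  also have "\<dots> = C ** A ** C" using AB BA by (simp add: matrix_mul_assoc)
  finally show ?thesis using C(2) by simp
qed

text \<open>The kernel of a symmetric matrix is the orthogonal complement of its range. Hence removing from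
\<open>x\<close> its component in the kernel leaves \<open>S *v x\<close> unchanged and moves \<open>x\<close> into the range; the
columns of \<open>C\<close> are obtained in this way from the standard basis vectors.\<close>
lemma symmetric_matrix_factors_through_square:
  fixes S :: "real^'n^'n"
  assumes "transpose S = S"
  obtains C where "S = S ** S ** C"
proof -
  have "\<exists>u. S *v x = S *v (S *v u)" for x
  proof -
    have sub: "span (range ((*v) S)) = range ((*v) S)"
      by (simp add: span_eq_iff linear_subspace_image)
    obtain y z where y: "y \<in> span (range ((*v) S))"
      and z: "\<And>w. w \<in> span (range ((*v) S)) \<Longrightarrow> orthogonal z w" and x: "x = y + z"
      using orthogonal_subspace_decomp_exists[of "range ((*v) S)" x] by metis
    have "(S *v z) \<bullet> (S *v z) = z \<bullet> (S *v (S *v z))"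
      using assms by (metis dot_lmul_matrix transpose_matrix_vector)
    also have "\<dots> = 0" using z[of "S *v (S *v z)"] sub by (auto simp: orthogonal_def)
    finally have "S *v z = 0" by simp
    moreover obtain u where "y = S *v u" using y sub by auto
    ultimately show ?thesis using x by (auto simp: matrix_vector_right_distrib)
  qed
  then obtain c where c: "\<And>x. S *v x = S *v (S *v c x)" by metis
  define C :: "real^'n^'n" where "C = (\<chi> i j. c (axis j 1) $ i)"
  have "S *v axis j 1 = (S ** S ** C) *v axis j 1" for j
  proof -
    have "C *v axis j 1 = c (axis j 1)"
      by (simp add: matrix_vector_mult_basis column_def C_def vec_eq_iff)
    then show ?thesis by (simp only: matrix_vector_mul_assoc[symmetric] c[of "axis j 1", symmetric])
  qed
  then have "column j S = column j (S ** S ** C)" for j by (simp add: matrix_vector_mult_basis)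
  then have "S = S ** S ** C" by (simp add: column_def vec_eq_iff)
  then show ?thesis by (rule that)
qed

text \<open>The definition by a definite description is useful only together with existence. From \<open>S = S ** S ** C\<close> and
its transpose one gets \<open>S ** C = transpose C ** S\<close>; this matrix \<open>e\<close> is a symmetric idempotent (the projection
onto the range of \<open>S\<close>), and \<open>transpose C ** S ** C\<close> satisfies the four Penrose equations.\<close>
lemma mult_moore_penrose_inverse_mult_symmetric:
  fixes S :: "real^'n^'n"
  assumes S: "transpose S = S"
  defines "B \<equiv> moore_penrose_inverse S"
  shows "S ** B ** S = S"
proof -
  obtain C where "S = S ** S ** C" using symmetric_matrix_factors_through_square[OF S] .
  then have C: "S ** S ** C = S" by (rule sym)
  have C': "transpose C ** S ** S = S"
    using arg_cong[OF C, of transpose] by (simp add: S matrix_transpose_mul matrix_mul_assoc)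
  define e where "e = S ** C"
  have e1: "transpose C ** S = e"
  proof -
    have "transpose C ** S = transpose C ** (S ** S ** C)" using C by simp
    also have "\<dots> = (transpose C ** S ** S) ** C" by (simp add: matrix_mul_assoc)
    finally show ?thesis using C' by (simp add: e_def)
  qed
  have te: "transpose e = e"
    using e1 by (simp add: e_def matrix_transpose_mul S)
  have eS: "e ** S = S" using C' by (simp add: e1)
  have Se: "S ** e = S" using C by (simp add: e_def matrix_mul_assoc)
  \<comment> \<open>This is \<open>transpose C ** S ** C\<close>, written with the projection \<open>e\<close>.\<close>
  define G where "G = transpose C ** e"
  have G2: "G = e ** C" using e1 by (simp add: G_def e_def matrix_mul_assoc)
  have SG: "S ** G = e" using Se by (simp add: G2 e_def matrix_mul_assoc)
  have GS: "G ** S = e" using eS e1 by (simp add: G_def matrix_mul_assoc[symmetric])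
  have ee: "e ** e = e" using eS by (simp add: e_def matrix_mul_assoc)
  have "G ** S ** G = e ** (e ** C)" using GS by (simp add: G2)
  then have "G ** S ** G = G" using ee by (simp add: G2 matrix_mul_assoc)
  then have G: "S ** G ** S = S" "G ** S ** G = G" "transpose (S ** G) = S ** G"
      "transpose (G ** S) = G ** S"
    using SG GS eS te by simp_all
  have "B = G" unfolding B_def moore_penrose_inverse_def
    by (rule the_equality, use G in blast) (rule moore_penrose_unique[OF _ _ _ _ G]; blast)
  then show ?thesis using G(1) by simp
qed

section \<open>Square-integrable random vectors\<close>

lemma integrable_mult_of_squares:
  fixes f g :: "'a \<Rightarrow> real"
  assumes [measurable]: "f \<in> borel_measurable M" "g \<in> borel_measurable M"
    and "integrable M (\<lambda>x. (f x)\<^sup>2)" "integrable M (\<lambda>x. (g x)\<^sup>2)"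
  shows "integrable M (\<lambda>x. f x * g x)"
proof (rule Bochner_Integration.integrable_bound)
  show "integrable M (\<lambda>x. (f x)\<^sup>2 + (g x)\<^sup>2)" using assms by simp
  show "AE x in M. norm (f x * g x) \<le> norm ((f x)\<^sup>2 + (g x)\<^sup>2)"
  proof (rule AE_I2)
    fix x
    have "2 * (\<bar>f x\<bar> * \<bar>g x\<bar>) \<le> (f x)\<^sup>2 + (g x)\<^sup>2"
      using sum_squares_bound[of "\<bar>f x\<bar>" "\<bar>g x\<bar>"] by (simp add: mult.assoc)
    moreover have "0 \<le> \<bar>f x\<bar> * \<bar>g x\<bar>" by simp
    ultimately have "\<bar>f x\<bar> * \<bar>g x\<bar> \<le> (f x)\<^sup>2 + (g x)\<^sup>2" by linarith
    then show "norm (f x * g x) \<le> norm ((f x)\<^sup>2 + (g x)\<^sup>2)" by (simp add: abs_mult)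
  qed
qed simp

lemma borel_measurable_vec_nth [measurable (raw)]:
  fixes Z :: "'a \<Rightarrow> real^'n"
  assumes [measurable]: "Z \<in> borel_measurable M"
  shows "(\<lambda>x. Z x $ i) \<in> borel_measurable M"
proof -
  have "(\<lambda>x. Z x \<bullet> axis i 1) \<in> borel_measurable M" by measurable
  then show ?thesis by (simp add: inner_axis)
qed

lemma borel_measurable_matrix_vector_mult [measurable]:
  fixes A :: "real^'n^'m"
  shows "(\<lambda>y. A *v y) \<in> borel_measurable borel"
  by (intro borel_measurable_continuous_onI linear_continuous_on matrix_vector_mul_bounded_linear)

lemma integrable_norm_square_iff:
  fixes Z :: "'a \<Rightarrow> real^'n"
  assumes [measurable]: "Z \<in> borel_measurable M"
  shows "integrable M (\<lambda>x. (norm (Z x))\<^sup>2) \<longleftrightarrow> (\<forall>i. integrable M (\<lambda>x. (Z x $ i)\<^sup>2))"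
proof
  assume I: "integrable M (\<lambda>x. (norm (Z x))\<^sup>2)"
  show "\<forall>i. integrable M (\<lambda>x. (Z x $ i)\<^sup>2)"
  proof
    fix i
    show "integrable M (\<lambda>x. (Z x $ i)\<^sup>2)"
      by (rule Bochner_Integration.integrable_bound[OF I])
        (auto intro!: AE_I2 power2_le_iff_abs_le[THEN iffD2] component_le_norm_cart simp: abs_le_square_iff[symmetric])
  qed
next
  assume "\<forall>i. integrable M (\<lambda>x. (Z x $ i)\<^sup>2)"
  then have "integrable M (\<lambda>x. \<Sum>i\<in>UNIV. (Z x $ i)\<^sup>2)" by simp
  then show "integrable M (\<lambda>x. (norm (Z x))\<^sup>2)"
    unfolding power2_norm_eq_inner inner_vec_def by (simp add: power2_eq_square)
qed

text \<open>By the parallelogram law.\<close>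
lemma integrable_norm_square_diff:
  fixes Z W :: "'a \<Rightarrow> real^'n"
  assumes [measurable]: "Z \<in> borel_measurable M" "W \<in> borel_measurable M"
    and "integrable M (\<lambda>x. (norm (Z x))\<^sup>2)" "integrable M (\<lambda>x. (norm (W x))\<^sup>2)"
  shows "integrable M (\<lambda>x. (norm (Z x - W x))\<^sup>2)"
proof (rule Bochner_Integration.integrable_bound)
  show "integrable M (\<lambda>x. 2 * (norm (Z x))\<^sup>2 + 2 * (norm (W x))\<^sup>2)" using assms by simp
  show "AE x in M. norm ((norm (Z x - W x))\<^sup>2) \<le> norm (2 * (norm (Z x))\<^sup>2 + 2 * (norm (W x))\<^sup>2)"
  proof (rule AE_I2)
    fix x
    have "(norm (Z x - W x))\<^sup>2 + (norm (Z x + W x))\<^sup>2 = 2 * (norm (Z x))\<^sup>2 + 2 * (norm (W x))\<^sup>2"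
      by (simp add: power2_norm_eq_inner inner_diff_left inner_diff_right inner_add_left inner_add_right
          inner_commute)
    then have "(norm (Z x - W x))\<^sup>2 \<le> 2 * (norm (Z x))\<^sup>2 + 2 * (norm (W x))\<^sup>2"
      using zero_le_power2[of "norm (Z x + W x)"] by linarith
    then show "norm ((norm (Z x - W x))\<^sup>2) \<le> norm (2 * (norm (Z x))\<^sup>2 + 2 * (norm (W x))\<^sup>2)" by simp
  qed
qed simp

lemma integrable_vec_nth:
  fixes Z :: "'a \<Rightarrow> real^'n"
  assumes "integrable M Z"
  shows "integrable M (\<lambda>x. Z x $ i)"
proof -
  have "integrable M (\<lambda>x. Z x \<bullet> axis i 1)" using assms by simp
  then show ?thesis by (simp add: inner_axis)
qed

lemma integral_vec_nth:
  fixes Z :: "'a \<Rightarrow> real^'n"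
  assumes "integrable M Z"
  shows "(\<integral>x. Z x \<partial>M) $ i = (\<integral>x. Z x $ i \<partial>M)"
  using integral_inner_left[of "axis i 1" M Z] assms by (simp add: inner_axis)

lemma integrable_inner_of_squares:
  fixes Z W :: "'a \<Rightarrow> real^'n"
  assumes [measurable]: "Z \<in> borel_measurable M" "W \<in> borel_measurable M"
    and "integrable M (\<lambda>x. (norm (Z x))\<^sup>2)" "integrable M (\<lambda>x. (norm (W x))\<^sup>2)"
  shows "integrable M (\<lambda>x. Z x \<bullet> W x)"
proof -
  have "integrable M (\<lambda>x. Z x $ i * W x $ i)" for i
    using assms by (intro integrable_mult_of_squares) (auto simp: integrable_norm_square_iff)
  then show ?thesis unfolding inner_vec_def by simp
qed

lemma transpose_var_matrix: "transpose (var_matrix M Z) = var_matrix M Z"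
  by (simp add: cov_matrix_def transpose_def vec_eq_iff mult.commute)

context prob_space
begin

lemma integrable_if_norm_square:
  fixes Z :: "'a \<Rightarrow> real^'n"
  assumes [measurable]: "Z \<in> borel_measurable M" and "integrable M (\<lambda>\<omega>. (norm (Z \<omega>))\<^sup>2)"
  shows "integrable M Z"
proof -
  have "integrable M (\<lambda>\<omega>. norm (Z \<omega>))" by (rule square_integrable_imp_integrable) (use assms in auto)
  then show ?thesis by (simp add: integrable_norm_iff)
qed

lemma cov_matrix_eq:
  fixes Z :: "'a \<Rightarrow> real^'n" and W :: "'a \<Rightarrow> real^'m"
  assumes [measurable]: "Z \<in> borel_measurable M" "W \<in> borel_measurable M"
    and Z: "integrable M (\<lambda>\<omega>. (norm (Z \<omega>))\<^sup>2)" and W: "integrable M (\<lambda>\<omega>. (norm (W \<omega>))\<^sup>2)"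
  shows "cov_matrix M Z W $ i $ j =
    (\<integral>\<omega>. Z \<omega> $ i * W \<omega> $ j \<partial>M) - (\<integral>\<omega>. Z \<omega> $ i \<partial>M) * (\<integral>\<omega>. W \<omega> $ j \<partial>M)"
proof -
  have Z2: "integrable M (\<lambda>\<omega>. (Z \<omega> $ i)\<^sup>2)" using Z by (simp add: integrable_norm_square_iff)
  have W2: "integrable M (\<lambda>\<omega>. (W \<omega> $ j)\<^sup>2)" using W by (simp add: integrable_norm_square_iff)
  have Z1: "integrable M (\<lambda>\<omega>. Z \<omega> $ i)" by (rule square_integrable_imp_integrable[OF _ Z2]) simp
  have W1: "integrable M (\<lambda>\<omega>. W \<omega> $ j)" by (rule square_integrable_imp_integrable[OF _ W2]) simp
  have ZW: "integrable M (\<lambda>\<omega>. Z \<omega> $ i * W \<omega> $ j)" by (rule integrable_mult_of_squares[OF _ _ Z2 W2]) simp_all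
  define a where "a = (\<integral>\<omega>. Z \<omega> $ i \<partial>M)"
  define b where "b = (\<integral>\<omega>. W \<omega> $ j \<partial>M)"
  have "cov_matrix M Z W $ i $ j = (\<integral>\<omega>. (Z \<omega> $ i - a) * (W \<omega> $ j - b) \<partial>M)"
    by (simp add: cov_matrix_def a_def b_def)
  also have "\<dots> = (\<integral>\<omega>. Z \<omega> $ i * W \<omega> $ j - a * W \<omega> $ j - b * Z \<omega> $ i + a * b \<partial>M)"
    by (simp add: algebra_simps)
  also have "\<dots> = (\<integral>\<omega>. Z \<omega> $ i * W \<omega> $ j \<partial>M) - a * b - b * a + a * b"
    using ZW Z1 W1 by (simp add: prob_space a_def b_def)
  finally show ?thesis by (simp add: a_def b_def)
qed

text \<open>\<open>R\<close> projects onto the orthogonal complement of the range of the covariance matrix \<open>V\<close>. Each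
coordinate of the projected centred vector has second moment \<open>(R ** V ** transpose R) $ i $ i = 0\<close>, so the
projection vanishes almost surely.\<close>
lemma AE_centered_in_range_var_matrix:
  fixes Z :: "'a \<Rightarrow> real^'n"
  assumes [measurable]: "Z \<in> borel_measurable M" and Z: "integrable M (\<lambda>\<omega>. (norm (Z \<omega>))\<^sup>2)"
  shows "AE \<omega> in M. Z \<omega> - (\<integral>\<omega>. Z \<omega> \<partial>M) \<in> range ((*v) (var_matrix M Z))"
proof -
  define V where "V = var_matrix M Z"
  define B where "B = moore_penrose_inverse V"
  define R where "R = mat 1 - V ** B"
  define W where "W \<omega> = Z \<omega> - (\<integral>\<omega>. Z \<omega> \<partial>M)" for \<omega>
  have [measurable]: "W \<in> borel_measurable M" unfolding W_def by measurable
  have I: "integrable M Z"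
    by (rule integrable_if_norm_square) (simp_all add: Z)
  have W: "integrable M (\<lambda>\<omega>. (norm (W \<omega>))\<^sup>2)"
    unfolding W_def by (rule integrable_norm_square_diff) (use Z in simp_all)
  have WW: "integrable M (\<lambda>\<omega>. W \<omega> $ j * W \<omega> $ k)" for j k
    using W by (intro integrable_mult_of_squares) (simp_all add: integrable_norm_square_iff)
  have V: "V $ j $ k = (\<integral>\<omega>. W \<omega> $ j * W \<omega> $ k \<partial>M)" for j k
    using I by (simp add: V_def cov_matrix_def W_def integral_vec_nth)
  have "V ** B ** V = V"
    unfolding B_def by (rule mult_moore_penrose_inverse_mult_symmetric) (simp add: V_def transpose_var_matrix)
  moreover have "R ** V = mat 1 ** V - V ** B ** V"
    unfolding R_def
    by (simp only: matrix_matrix_mult_def vec_eq_iff vec_lambda_beta vector_minus_component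
        left_diff_distrib sum_subtractf simp_thms)
  ultimately have RV: "R ** V = 0" by simp
  have "AE \<omega> in M. (R *v W \<omega>) $ i = 0" for i
  proof -
    have sq: "((R *v W \<omega>) $ i)\<^sup>2 = (\<Sum>k\<in>UNIV. \<Sum>j\<in>UNIV. R $ i $ k * R $ i $ j * (W \<omega> $ j * W \<omega> $ k))" for \<omega>
      by (simp add: matrix_vector_mult_def power2_eq_square sum_product mult_ac)
    have int: "integrable M (\<lambda>\<omega>. ((R *v W \<omega>) $ i)\<^sup>2)" unfolding sq using WW by simp
    have "(\<integral>\<omega>. ((R *v W \<omega>) $ i)\<^sup>2 \<partial>M) = (\<Sum>k\<in>UNIV. R $ i $ k * (\<Sum>j\<in>UNIV. R $ i $ j * V $ j $ k))"
      unfolding sq V using WW by (simp add: sum_distrib_left mult.assoc)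
    also have "\<dots> = (\<Sum>k\<in>UNIV. R $ i $ k * (R ** V) $ i $ k)" by (simp add: matrix_matrix_mult_def)
    also have "\<dots> = 0" by (simp add: RV)
    finally have "AE \<omega> in M. ((R *v W \<omega>) $ i)\<^sup>2 = 0"
      using integral_nonneg_eq_0_iff_AE[OF int] by simp
    then show ?thesis by simp
  qed
  then have "AE \<omega> in M. \<forall>i\<in>UNIV. (R *v W \<omega>) $ i = 0" by (intro AE_finite_allI) auto
  then show ?thesis
  proof eventually_elim
    fix \<omega> assume "\<forall>i\<in>UNIV. (R *v W \<omega>) $ i = 0"
    then have "R *v W \<omega> = 0" by (simp add: vec_eq_iff)
    then have "W \<omega> = V *v (B *v W \<omega>)"
      by (simp add: R_def matrix_vector_mult_diff_rdistrib matrix_vector_mul_assoc)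
    then show "Z \<omega> - (\<integral>\<omega>. Z \<omega> \<partial>M) \<in> range ((*v) (var_matrix M Z))"
      unfolding W_def V_def by blast
  qed
qed

end

section \<open>Factorization and independence\<close>

text \<open>The Doob-Dynkin lemma, by induction along the construction of nonnegative measurable functions from indicators;
suprema of the factors are taken pointwise, so no convergence question arises.\<close>
lemma nonneg_factor_through_vimage_algebra:
  fixes f :: "'a \<Rightarrow> ennreal"
  assumes "f \<in> borel_measurable (vimage_algebra X Y N)" and Y: "Y \<in> X \<rightarrow> space N"
  shows "\<exists>g\<in>borel_measurable N. \<forall>x\<in>X. f x = g (Y x)"
  using assms(1)
proof (induction rule: borel_measurable_induct)
  case (cong f g)
  then obtain h where "h \<in> borel_measurable N" "\<forall>x\<in>X. g x = h (Y x)" by blast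
  with cong.hyps show ?case by (intro bexI[of _ h]) auto
next
  case (set A)
  then obtain B where "B \<in> sets N" "A = Y -` B \<inter> X"
    using sets_vimage_algebra2[OF Y] by auto
  then show ?case by (intro bexI[of _ "indicator B"]) (auto simp: indicator_def)
next
  case (mult u c)
  obtain g where "g \<in> borel_measurable N" "\<forall>x\<in>X. u x = g (Y x)" using mult.IH by blast
  then show ?case by (intro bexI[of _ "\<lambda>y. c * g y"]) auto
next
  case (add u v)
  obtain g h where "g \<in> borel_measurable N" "\<forall>x\<in>X. u x = g (Y x)"
    "h \<in> borel_measurable N" "\<forall>x\<in>X. v x = h (Y x)" using add.IH by blast
  then show ?case by (intro bexI[of _ "\<lambda>y. h y + g y"]) auto
next
  case (seq U)
  obtain g where "\<And>i. g i \<in> borel_measurable N" "\<And>i x. x \<in> X \<Longrightarrow> U i x = g i (Y x)"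
    using seq.IH by metis
  then show ?case
    by (intro bexI[of _ "\<lambda>y. SUP i. g i y"]) (auto simp: image_comp)
qed

lemma real_factor_through_vimage_algebra:
  fixes f :: "'a \<Rightarrow> real"
  assumes [measurable]: "f \<in> borel_measurable (vimage_algebra X Y N)" and Y: "Y \<in> X \<rightarrow> space N"
  shows "\<exists>g\<in>borel_measurable N. \<forall>x\<in>X. f x = g (Y x)"
proof -
  obtain p q where [measurable]: "p \<in> borel_measurable N" "q \<in> borel_measurable N"
    and pq: "\<forall>x\<in>X. ennreal (f x) = p (Y x)" "\<forall>x\<in>X. ennreal (- f x) = q (Y x)"
    using nonneg_factor_through_vimage_algebra[of "\<lambda>x. ennreal (f x)", OF _ Y]
      nonneg_factor_through_vimage_algebra[of "\<lambda>x. ennreal (- f x)", OF _ Y] by auto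
  have "f x = enn2real (p (Y x)) - enn2real (q (Y x))" if "x \<in> X" for x
  proof -
    have "p (Y x) = ennreal (f x)" "q (Y x) = ennreal (- f x)" using that pq by simp_all
    then show ?thesis by (cases "0 \<le> f x") (simp_all add: ennreal_neg)
  qed
  then show ?thesis by (intro bexI[of _ "\<lambda>y. enn2real (p y) - enn2real (q y)"]) auto
qed

text \<open>Restricting the probability to the event \<open>U = u\<close> only rescales the law of the independent \<open>B\<close>.\<close>
lemma nn_integral_indep_rv:
  assumes "prob_space N" and "indep_rv N (count_space UNIV) U T B" and [measurable]: "h \<in> borel_measurable T"
  shows "(\<integral>\<^sup>+\<omega>. indicator {u} (U \<omega>) * h (B \<omega>) \<partial>N) =
    emeasure (distr N (count_space UNIV) U) {u} * (\<integral>\<^sup>+\<omega>. h (B \<omega>) \<partial>N)"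
proof -
  interpret prob_space N by fact
  have [measurable]: "U \<in> measurable N (count_space UNIV)" "B \<in> measurable N T"
    and ind: "indep_set (sets (vimage_algebra (space N) U (count_space UNIV)))
                        (sets (vimage_algebra (space N) B T))"
    using assms(2) by (auto simp: indep_rv_def)
  have [measurable]: "(\<lambda>\<omega>. indicator {u} (U \<omega>) :: ennreal) \<in> borel_measurable N"
    by (rule measurable_compose[where N = "count_space UNIV"]) auto
  let ?D = "density N (\<lambda>\<omega>. indicator {u} (U \<omega>))"
  let ?p = "emeasure (distr N (count_space UNIV) U) {u}"
  have "distr ?D T B = scale_measure ?p (distr N T B)"
  proof (rule measure_eqI)
    fix A assume "A \<in> sets (distr ?D T B)"
    then have A [measurable]: "A \<in> sets T" by simp
    have "emeasure (distr ?D T B) A = emeasure ?D (B -` A \<inter> space N)"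
      by (subst emeasure_distr) (auto simp: space_density)
    also have "\<dots> = (\<integral>\<^sup>+\<omega>. indicator {u} (U \<omega>) * indicator (B -` A \<inter> space N) \<omega> \<partial>N)"
      by (rule emeasure_density) auto
    also have "\<dots> = (\<integral>\<^sup>+\<omega>. indicator ((U -` {u} \<inter> space N) \<inter> (B -` A \<inter> space N)) \<omega> \<partial>N)"
      by (intro nn_integral_cong) (auto simp: indicator_def)
    also have "\<dots> = emeasure N ((U -` {u} \<inter> space N) \<inter> (B -` A \<inter> space N))"
      by (rule nn_integral_indicator) auto
    also have "\<dots> = emeasure N (U -` {u} \<inter> space N) * emeasure N (B -` A \<inter> space N)"
      unfolding emeasure_eq_measure
      by (subst indep_setD[OF ind]) (auto intro!: in_vimage_algebra simp: ennreal_mult)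
    also have "\<dots> = emeasure (scale_measure ?p (distr N T B)) A"
      by (simp add: emeasure_distr)
    finally show "emeasure (distr ?D T B) A = emeasure (scale_measure ?p (distr N T B)) A" .
  qed simp
  then have "(\<integral>\<^sup>+x. h x \<partial>distr ?D T B) = (\<integral>\<^sup>+x. h x \<partial>scale_measure ?p (distr N T B))" by simp
  then show ?thesis
    by (simp add: nn_integral_distr nn_integral_density nn_integral_scale_measure)
qed

lemma indep_rv_fst_snd:
  assumes "prob_space A" and "prob_space B" and [measurable]: "a \<in> measurable A S" "h \<in> measurable B T"
  shows "indep_rv (A \<Otimes>\<^sub>M B) S (\<lambda>\<omega>. a (fst \<omega>)) T (\<lambda>\<omega>. h (snd \<omega>))"
proof -
  interpret A: prob_space A by fact
  interpret B: prob_space B by fact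
  interpret AB: pair_prob_space A B ..
  have a: "(\<lambda>\<omega>. a (fst \<omega>)) \<in> space (A \<Otimes>\<^sub>M B) \<rightarrow> space S"
    and h: "(\<lambda>\<omega>. h (snd \<omega>)) \<in> space (A \<Otimes>\<^sub>M B) \<rightarrow> space T"
    using assms(3,4)[THEN measurable_space] by (auto simp: space_pair_measure)
  show ?thesis
    unfolding indep_rv_def
  proof (intro conjI AB.indep_setI)
    fix E F assume "E \<in> sets (vimage_algebra (space (A \<Otimes>\<^sub>M B)) (\<lambda>\<omega>. a (fst \<omega>)) S)"
      and "F \<in> sets (vimage_algebra (space (A \<Otimes>\<^sub>M B)) (\<lambda>\<omega>. h (snd \<omega>)) T)"
    then obtain E' F' where E': "E' \<in> sets S" "E = (\<lambda>\<omega>. a (fst \<omega>)) -` E' \<inter> space (A \<Otimes>\<^sub>M B)"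
      and F': "F' \<in> sets T" "F = (\<lambda>\<omega>. h (snd \<omega>)) -` F' \<inter> space (A \<Otimes>\<^sub>M B)"
      using a h by (auto simp: sets_vimage_algebra2)
    note [measurable] = E'(1) F'(1)
    have E: "E = (a -` E' \<inter> space A) \<times> space B" and F: "F = space A \<times> (h -` F' \<inter> space B)"
      using E'(2) F'(2) by (auto simp: space_pair_measure)
    have "E \<inter> F = (a -` E' \<inter> space A) \<times> (h -` F' \<inter> space B)" using E F by auto
    then show "AB.prob (E \<inter> F) = AB.prob E * AB.prob F"
      unfolding E F by (simp add: measure_def B.emeasure_pair_measure_Times enn2real_mult B.emeasure_space_1 A.emeasure_space_1)
  qed (auto simp: sets_vimage_algebra2[OF a] sets_vimage_algebra2[OF h])
qed

lemma distr_pair_snd: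
  assumes "prob_space A" and "sigma_finite_measure B"
  shows "distr (A \<Otimes>\<^sub>M B) B snd = B"
proof (rule measure_eqI)
  interpret A: prob_space A by fact
  interpret B: sigma_finite_measure B by fact
  fix E assume "E \<in> sets (distr (A \<Otimes>\<^sub>M B) B snd)"
  then have E: "E \<in> sets B" by simp
  then have "snd -` E \<inter> space (A \<Otimes>\<^sub>M B) = space A \<times> E"
    using sets.sets_into_space by (auto simp: space_pair_measure)
  then show "emeasure (distr (A \<Otimes>\<^sub>M B) B snd) E = emeasure B E"
    using E by (simp add: emeasure_distr B.emeasure_pair_measure_Times A.emeasure_space_1)
qed simp

section \<open>The laws in the outlier neighbourhood and their risk\<close>

locale ideal_model = prob_space M for M :: "'a measure" +
  fixes X eps :: "'a \<Rightarrow> real^'n"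
  assumes indep: "indep_var borel X borel eps"
    and X_square: "integrable M (\<lambda>\<omega>. (norm (X \<omega>))\<^sup>2)"
    and eps_square: "integrable M (\<lambda>\<omega>. (norm (eps \<omega>))\<^sup>2)"
    and eps_mean: "(\<integral>\<omega>. eps \<omega> \<partial>M) = 0"
begin

abbreviation Y :: "'a \<Rightarrow> real^'n" where "Y \<equiv> \<lambda>\<omega>. X \<omega> + eps \<omega>"

lemma X_measurable [measurable]: "X \<in> borel_measurable M"
  and eps_measurable [measurable]: "eps \<in> borel_measurable M"
  using indep_var_rv1[OF indep] indep_var_rv2[OF indep] by simp_all

lemma integrable_X: "integrable M X" and integrable_eps: "integrable M eps"
  by (rule integrable_if_norm_square; simp add: X_square eps_square)+

text \<open>Any probability measure can serve as contaminating law: take \<open>U\<close>, \<open>X\<close>, \<open>eps\<close> and \<open>Ydi\<close> to be the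
coordinates of a product space, in which all four are independent.\<close>
lemma io_law_exists:
  assumes G: "prob_space G" and sets_G [measurable_cong]: "sets G = sets borel"
    and s: "0 \<le> s" "s \<le> 1"
  shows "\<exists>P. io_law M X eps s G P"
proof -
  define LX where "LX = distr M borel X"
  define Le where "Le = distr M borel eps"
  define B where "B = measure_pmf (binomial_pmf 1 s)"
  have [measurable_cong]: "sets LX = sets borel" "sets Le = sets borel"
    "sets B = sets (count_space UNIV)"
    by (simp_all add: LX_def Le_def B_def)
  interpret G: prob_space G by fact
  interpret LX: prob_space LX unfolding LX_def by (rule prob_space_distr) simp
  interpret Le: prob_space Le unfolding Le_def by (rule prob_space_distr) simp
  interpret B: prob_space B unfolding B_def by (rule prob_space_measure_pmf)
  interpret eG: pair_prob_space Le G ..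
  interpret XeG: pair_prob_space LX "Le \<Otimes>\<^sub>M G" ..
  interpret N: pair_prob_space B "LX \<Otimes>\<^sub>M (Le \<Otimes>\<^sub>M G)" ..
  let ?N = "B \<Otimes>\<^sub>M (LX \<Otimes>\<^sub>M (Le \<Otimes>\<^sub>M G))"
  let ?U = "\<lambda>\<omega>. fst \<omega> :: nat"
  let ?X = "\<lambda>\<omega>. fst (snd \<omega>) :: real^'n"
  let ?e = "\<lambda>\<omega>. fst (snd (snd \<omega>)) :: real^'n"
  let ?Y = "\<lambda>\<omega>. snd (snd (snd \<omega>)) :: real^'n"
  have snd: "distr ?N (LX \<Otimes>\<^sub>M (Le \<Otimes>\<^sub>M G)) snd = LX \<Otimes>\<^sub>M (Le \<Otimes>\<^sub>M G)"
    by (rule distr_pair_snd) unfold_locales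
  have snd2: "distr (LX \<Otimes>\<^sub>M (Le \<Otimes>\<^sub>M G)) (Le \<Otimes>\<^sub>M G) snd = Le \<Otimes>\<^sub>M G"
    by (rule distr_pair_snd) unfold_locales
  have eY: "distr ?N (Le \<Otimes>\<^sub>M G) (\<lambda>\<omega>. snd (snd \<omega>)) = Le \<Otimes>\<^sub>M G"
    using distr_distr[of snd "LX \<Otimes>\<^sub>M (Le \<Otimes>\<^sub>M G)" "Le \<Otimes>\<^sub>M G" snd ?N] snd snd2 by (simp add: comp_def)
  have e: "distr ?N borel ?e = Le"
  proof -
    have "distr ?N borel ?e = distr (distr ?N (Le \<Otimes>\<^sub>M G) (\<lambda>\<omega>. snd (snd \<omega>))) borel fst"
      by (subst distr_distr) (simp_all add: comp_def)
    also have "\<dots> = distr (Le \<Otimes>\<^sub>M G) Le fst" unfolding eY by (rule distr_cong) (simp_all add: Le_def)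
    finally show ?thesis using G.distr_pair_fst by simp
  qed
  have Y: "distr ?N borel ?Y = G"
  proof -
    have "distr ?N borel ?Y = distr (distr ?N (Le \<Otimes>\<^sub>M G) (\<lambda>\<omega>. snd (snd \<omega>))) borel snd"
      by (subst distr_distr) (simp_all add: comp_def)
    also have "\<dots> = distr (Le \<Otimes>\<^sub>M G) G snd" unfolding eY by (rule distr_cong) (simp_all add: sets_G)
    also have "\<dots> = G" by (rule distr_pair_snd) unfold_locales
    finally show ?thesis .
  qed
  have "io_model M X eps s ?N ?X ?e ?U ?Y"
    unfolding io_model_def
  proof (intro conjI)
    show "prob_space ?N" by unfold_locales
    show "distr ?N borel (\<lambda>\<omega>. (?X \<omega>, ?e \<omega>)) = distr M borel (\<lambda>\<omega>. (X \<omega>, eps \<omega>))"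
    proof -
      have "distr ?N borel (\<lambda>\<omega>. (?X \<omega>, ?e \<omega>)) =
          distr (distr ?N (LX \<Otimes>\<^sub>M (Le \<Otimes>\<^sub>M G)) snd) (borel \<Otimes>\<^sub>M borel) (\<lambda>\<omega>. (fst \<omega>, fst (snd \<omega>)))"
        by (subst distr_distr) (simp_all add: comp_def borel_prod)
      also have "\<dots> = distr (LX \<Otimes>\<^sub>M (Le \<Otimes>\<^sub>M G)) (borel \<Otimes>\<^sub>M borel) (\<lambda>(x, z). ((\<lambda>x. x) x, fst z))"
        unfolding snd by (rule distr_cong) auto
      also have "\<dots> = distr LX borel (\<lambda>x. x) \<Otimes>\<^sub>M distr (Le \<Otimes>\<^sub>M G) borel fst"
        by (rule pair_measure_distr[symmetric]) (auto intro!: Le.sigma_finite_measure_axioms prob_space_imp_sigma_finite eG.prob_space_distr)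
      also have "distr LX borel (\<lambda>x. x) = LX" by (rule distr_id2) (simp add: LX_def)
      also have "distr (Le \<Otimes>\<^sub>M G) borel fst = distr (Le \<Otimes>\<^sub>M G) Le fst"
        by (rule distr_cong) (simp_all add: Le_def)
      also have "\<dots> = Le" by (rule G.distr_pair_fst)
      also have "LX \<Otimes>\<^sub>M Le = distr M (borel \<Otimes>\<^sub>M borel) (\<lambda>\<omega>. (X \<omega>, eps \<omega>))"
        using indep by (simp add: indep_var_distribution_eq LX_def Le_def)
      finally show ?thesis by (simp add: borel_prod)
    qed
    show "distr ?N (count_space UNIV) ?U = measure_pmf (binomial_pmf 1 s)"
    proof -
      have "distr ?N (count_space UNIV) ?U = distr ?N B ?U"
        by (rule distr_cong) (simp_all add: B_def)
      then show ?thesis using XeG.distr_pair_fst by (simp add: B_def)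
    qed
    show "indep_rv ?N (count_space UNIV) ?U borel (\<lambda>\<omega>. (?e \<omega>, ?X \<omega> + ?e \<omega>))"
      by (rule indep_rv_fst_snd[where a = "\<lambda>x. x" and h = "\<lambda>z. (fst (snd z), fst z + fst (snd z))"])
        (unfold_locales, simp_all add: borel_prod[symmetric])
    show "indep_rv ?N (count_space UNIV) ?U borel (\<lambda>\<omega>. (?e \<omega>, ?Y \<omega>))"
      by (rule indep_rv_fst_snd[where a = "\<lambda>x. x" and h = "\<lambda>z. (fst (snd z), snd (snd z))"])
        (unfold_locales, simp_all add: borel_prod[symmetric])
    show "N.indep_var borel ?e borel ?Y"
      unfolding N.indep_var_distribution_eq e Y
    proof (intro conjI)
      show "Le \<Otimes>\<^sub>M G = distr ?N (borel \<Otimes>\<^sub>M borel) (\<lambda>\<omega>. (?e \<omega>, ?Y \<omega>))"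
        by (subst eY[symmetric], rule distr_cong) (auto intro!: sets_pair_measure_cong simp: sets_G Le_def)
    qed simp_all
  qed simp_all
  then show ?thesis unfolding io_law_def using Y by metis
qed

text \<open>The mixture description of the law of \<open>(eps, Yre)\<close>. Given \<open>U = 0\<close> the pair is distributed as in
the ideal model, given \<open>U = 1\<close> as \<open>(eps, Ydi)\<close>, whose components are independent.
The contamination thus enters the law of \<open>(eps, Yre)\<close> through \<open>s\<close> and \<open>G\<close> alone.\<close>
lemma nn_integral_io_law:
  assumes "io_law M X eps s G P" and s: "0 \<le> s" "s \<le> 1"
    and h: "h \<in> borel_measurable borel"
  shows "(\<integral>\<^sup>+z. h z \<partial>P) =
    ennreal (1 - s) * (\<integral>\<^sup>+\<omega>. h (eps \<omega>, Y \<omega>) \<partial>M) +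
    ennreal s * (\<integral>\<^sup>+y. (\<integral>\<^sup>+\<omega>. h (eps \<omega>, y) \<partial>M) \<partial>G)"
proof -
  obtain N :: "(nat \<times> (real^'n) \<times> (real^'n) \<times> (real^'n)) measure" and X' eps' U Ydi
    where io: "io_model M X eps s N X' eps' U Ydi" and G: "G = distr N borel Ydi"
      and P: "P = distr N borel (\<lambda>\<omega>. (eps' \<omega>, y_re U (\<lambda>\<omega>. X' \<omega> + eps' \<omega>) Ydi \<omega>))"
    using assms(1) unfolding io_law_def by auto
  interpret N: prob_space N using io by (simp add: io_model_def)
  have [measurable]: "X' \<in> borel_measurable N" "eps' \<in> borel_measurable N"
      "U \<in> measurable N (count_space UNIV)"
    and joint: "distr N borel (\<lambda>\<omega>. (X' \<omega>, eps' \<omega>)) = distr M borel (\<lambda>\<omega>. (X \<omega>, eps \<omega>))"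
    and U: "distr N (count_space UNIV) U = measure_pmf (binomial_pmf 1 s)"
    and ind0: "indep_rv N (count_space UNIV) U borel (\<lambda>\<omega>. (eps' \<omega>, X' \<omega> + eps' \<omega>))"
    and ind1: "indep_rv N (count_space UNIV) U borel (\<lambda>\<omega>. (eps' \<omega>, Ydi \<omega>))"
    and indY: "N.indep_var borel eps' borel Ydi"
    using io by (auto simp: io_model_def)
  have Ydi [measurable]: "Ydi \<in> borel_measurable N" using N.indep_var_rv2[OF indY] by simp
  have h' [measurable]: "h \<in> borel_measurable (borel \<Otimes>\<^sub>M borel)" using h by (simp add: borel_prod)
  have [measurable]: "(\<lambda>\<omega>. real (U \<omega>)) \<in> borel_measurable N"
    "(\<lambda>\<omega>. indicator {0} (U \<omega>) :: ennreal) \<in> borel_measurable N"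
    "(\<lambda>\<omega>. indicator {1} (U \<omega>) :: ennreal) \<in> borel_measurable N"
    by (rule measurable_compose[where N = "count_space UNIV"], simp_all)+
  have yre [measurable]: "y_re U (\<lambda>\<omega>. X' \<omega> + eps' \<omega>) Ydi \<in> borel_measurable N"
    unfolding y_re_def by measurable
  have p: "emeasure (distr N (count_space UNIV) U) {0} = ennreal (1 - s)"
      "emeasure (distr N (count_space UNIV) U) {1} = ennreal s"
    unfolding U using s by (simp_all add: emeasure_pmf_single)
  have "AE u in distr N (count_space UNIV) U. u \<in> {0, 1}"
    unfolding U AE_measure_pmf_iff using set_pmf_binomial_eq[of s 1] s by auto
  then have U01: "AE \<omega> in N. U \<omega> = 0 \<or> U \<omega> = 1"
    by (subst (asm) AE_distr_iff) auto
  have "(\<integral>\<^sup>+z. h z \<partial>P) = (\<integral>\<^sup>+\<omega>. h (eps' \<omega>, y_re U (\<lambda>\<omega>. X' \<omega> + eps' \<omega>) Ydi \<omega>) \<partial>N)"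
    unfolding P using h by (subst nn_integral_distr) (simp_all add: borel_prod[symmetric])
  also have "\<dots> = (\<integral>\<^sup>+\<omega>. indicator {0} (U \<omega>) * h (eps' \<omega>, X' \<omega> + eps' \<omega>) +
      indicator {1} (U \<omega>) * h (eps' \<omega>, Ydi \<omega>) \<partial>N)"
    using U01 by (intro nn_integral_cong_AE, eventually_elim) (auto simp: y_re_def)
  also have "\<dots> = (\<integral>\<^sup>+\<omega>. indicator {0} (U \<omega>) * h (eps' \<omega>, X' \<omega> + eps' \<omega>) \<partial>N) +
      (\<integral>\<^sup>+\<omega>. indicator {1} (U \<omega>) * h (eps' \<omega>, Ydi \<omega>) \<partial>N)"
    by (rule nn_integral_add; measurable)
  also have "\<dots> = ennreal (1 - s) * (\<integral>\<^sup>+\<omega>. h (eps' \<omega>, X' \<omega> + eps' \<omega>) \<partial>N) +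
      ennreal s * (\<integral>\<^sup>+\<omega>. h (eps' \<omega>, Ydi \<omega>) \<partial>N)"
    using nn_integral_indep_rv[OF N.prob_space_axioms ind0 h, of 0]
      nn_integral_indep_rv[OF N.prob_space_axioms ind1 h, of 1] p by simp
  also have "(\<integral>\<^sup>+\<omega>. h (eps' \<omega>, X' \<omega> + eps' \<omega>) \<partial>N) = (\<integral>\<^sup>+\<omega>. h (eps \<omega>, Y \<omega>) \<partial>M)"
  proof -
    have [measurable]: "(\<lambda>z. h (snd z, fst z + snd z)) \<in> borel_measurable (borel \<Otimes>\<^sub>M borel)"
      by measurable
    have "(\<integral>\<^sup>+z. h (snd z, fst z + snd z) \<partial>distr N (borel \<Otimes>\<^sub>M borel) (\<lambda>\<omega>. (X' \<omega>, eps' \<omega>))) =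
        (\<integral>\<^sup>+z. h (snd z, fst z + snd z) \<partial>distr M (borel \<Otimes>\<^sub>M borel) (\<lambda>\<omega>. (X \<omega>, eps \<omega>)))"
      using joint by (simp add: borel_prod)
    then show ?thesis by (simp add: nn_integral_distr)
  qed
  also have "(\<integral>\<^sup>+\<omega>. h (eps' \<omega>, Ydi \<omega>) \<partial>N) = (\<integral>\<^sup>+y. (\<integral>\<^sup>+\<omega>. h (eps \<omega>, y) \<partial>M) \<partial>G)"
  proof -
    have eq: "distr N borel eps' = distr M borel eps"
    proof -
      have "distr (distr N borel (\<lambda>\<omega>. (X' \<omega>, eps' \<omega>))) borel snd =
          distr (distr M borel (\<lambda>\<omega>. (X \<omega>, eps \<omega>))) borel snd"
        using joint by simp
      then show ?thesis by (simp add: distr_distr comp_def borel_prod[symmetric])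
    qed
    interpret e: prob_space "distr M borel eps" by (rule prob_space_distr) simp
    interpret G: prob_space G unfolding G by (rule N.prob_space_distr) simp
    interpret eG: pair_prob_space "distr M borel eps" G ..
    have [measurable_cong]: "sets G = sets borel" by (simp add: G)
    have "(\<integral>\<^sup>+\<omega>. h (eps' \<omega>, Ydi \<omega>) \<partial>N) =
        (\<integral>\<^sup>+z. h z \<partial>distr N (borel \<Otimes>\<^sub>M borel) (\<lambda>\<omega>. (eps' \<omega>, Ydi \<omega>)))"
      by (simp add: nn_integral_distr)
    also have "distr N (borel \<Otimes>\<^sub>M borel) (\<lambda>\<omega>. (eps' \<omega>, Ydi \<omega>)) = distr M borel eps \<Otimes>\<^sub>M G"
      using indY by (simp add: N.indep_var_distribution_eq eq G)
    also have "(\<integral>\<^sup>+z. h z \<partial>(distr M borel eps \<Otimes>\<^sub>M G)) =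
        (\<integral>\<^sup>+y. (\<integral>\<^sup>+e. h (e, y) \<partial>distr M borel eps) \<partial>G)"
      by (subst eG.nn_integral_snd[symmetric]) (simp_all add: case_prod_unfold)
    also have "\<dots> = (\<integral>\<^sup>+y. (\<integral>\<^sup>+\<omega>. h (eps \<omega>, y) \<partial>M) \<partial>G)"
      by (intro nn_integral_cong nn_integral_distr) simp_all
    finally show ?thesis .
  qed
  finally show ?thesis .
qed

lemma integral_X_eps: "(\<integral>\<omega>. X \<omega> $ i * eps \<omega> $ j \<partial>M) = 0"
proof -
  have "indep_var borel (\<lambda>\<omega>. X \<omega> $ i) borel (\<lambda>\<omega>. eps \<omega> $ j)"
    using indep_var_compose[OF indep, of "\<lambda>x. x $ i" borel "\<lambda>x. x $ j" borel] by (simp add: comp_def)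
  then have "(\<integral>\<omega>. X \<omega> $ i * eps \<omega> $ j \<partial>M) = (\<integral>\<omega>. X \<omega> $ i \<partial>M) * (\<integral>\<omega>. eps \<omega> $ j \<partial>M)"
    by (rule indep_var_lebesgue_integral) (simp_all add: integrable_vec_nth integrable_X integrable_eps)
  also have "(\<integral>\<omega>. eps \<omega> $ j \<partial>M) = 0"
    using eps_mean integrable_eps by (simp add: integral_vec_nth[symmetric])
  finally show ?thesis by simp
qed

lemma Y_square: "integrable M (\<lambda>\<omega>. (norm (Y \<omega>))\<^sup>2)"
  using integrable_norm_square_diff[of X M "\<lambda>\<omega>. - eps \<omega>"] X_square eps_square by simp

lemma nn_integral_square_shift_eps:
  "(\<integral>\<^sup>+\<omega>. ennreal ((norm (c - eps \<omega>))\<^sup>2) \<partial>M) =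
    (\<integral>\<^sup>+\<omega>. ennreal ((norm (eps \<omega>))\<^sup>2) \<partial>M) + ennreal ((norm c)\<^sup>2)"
proof -
  have I: "integrable M (\<lambda>\<omega>. c \<bullet> eps \<omega>)" using integrable_eps by simp
  have z: "(\<integral>\<omega>. c \<bullet> eps \<omega> \<partial>M) = 0" using integrable_eps eps_mean by simp
  have eq: "(norm (c - eps \<omega>))\<^sup>2 = (norm (eps \<omega>))\<^sup>2 + (norm c)\<^sup>2 - 2 * (c \<bullet> eps \<omega>)" for \<omega>
    by (simp add: power2_norm_eq_inner inner_diff_left inner_diff_right inner_commute)
  have "(\<integral>\<^sup>+\<omega>. ennreal ((norm (c - eps \<omega>))\<^sup>2) \<partial>M) = ennreal (\<integral>\<omega>. (norm (c - eps \<omega>))\<^sup>2 \<partial>M)"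
    using integrable_norm_square_diff[of "\<lambda>_. c" M eps] eps_square by (intro nn_integral_eq_integral) auto
  also have "(\<integral>\<omega>. (norm (c - eps \<omega>))\<^sup>2 \<partial>M) = (\<integral>\<omega>. (norm (eps \<omega>))\<^sup>2 \<partial>M) + (norm c)\<^sup>2"
    unfolding eq using I z eps_square by (simp add: prob_space)
  also have "ennreal \<dots> = (\<integral>\<^sup>+\<omega>. ennreal ((norm (eps \<omega>))\<^sup>2) \<partial>M) + ennreal ((norm c)\<^sup>2)"
    using eps_square by (subst nn_integral_eq_integral) auto
  finally show ?thesis .
qed

lemma io_risk_eq:
  assumes "io_law M X eps s G P" and "0 \<le> s" "s \<le> 1" and [measurable]: "f \<in> borel_measurable borel"
  shows "io_risk P f =
    ennreal (1 - s) * (\<integral>\<^sup>+\<omega>. ennreal ((norm (eps \<omega> - (Y \<omega> - f (Y \<omega>))))\<^sup>2) \<partial>M) +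
    ennreal s * (\<integral>\<^sup>+y. (\<integral>\<^sup>+\<omega>. ennreal ((norm (eps \<omega>))\<^sup>2) \<partial>M) + ennreal ((norm (y - f y))\<^sup>2) \<partial>G)"
proof -
  define h where "h = (\<lambda>z. ennreal ((norm (snd z - fst z - f (snd z)))\<^sup>2))"
  have h: "h \<in> borel_measurable borel" unfolding h_def borel_prod[symmetric] by measurable
  have h1: "h (eps \<omega>, y) = ennreal ((norm ((y - f y) - eps \<omega>))\<^sup>2)" for \<omega> y
    by (simp add: h_def algebra_simps)
  have h2: "h (eps \<omega>, y) = ennreal ((norm (eps \<omega> - (y - f y)))\<^sup>2)" for \<omega> y
    unfolding h1 by (simp only: norm_minus_commute)
  have h3: "(\<integral>\<^sup>+\<omega>. h (eps \<omega>, y) \<partial>M) =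
      (\<integral>\<^sup>+\<omega>. ennreal ((norm (eps \<omega>))\<^sup>2) \<partial>M) + ennreal ((norm (y - f y))\<^sup>2)" for y
    unfolding h1 by (rule nn_integral_square_shift_eps)
  have "io_risk P f = (\<integral>\<^sup>+z. h z \<partial>P)" by (simp add: io_risk_def h_def case_prod_unfold)
  also note nn_integral_io_law[OF assms(1-3) h]
  finally show ?thesis unfolding h3 unfolding h2 .
qed

end

section \<open>Conditioning on the observation\<close>

lemma cond_exp_given_AE_eq:
  assumes "cond_exp_given M X Y m" and "cond_exp_given M X Y m'"
  shows "AE \<omega> in M. m (Y \<omega>) = m' (Y \<omega>)"
proof -
  have "AE \<omega> in M. m (Y \<omega>) $ i = m' (Y \<omega>) $ i" for i
    using assms[unfolded cond_exp_given_def, THEN conjunct2, THEN spec[of _ i]]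
    by eventually_elim simp
  then have "AE \<omega> in M. \<forall>i\<in>UNIV. m (Y \<omega>) $ i = m' (Y \<omega>) $ i" by (intro AE_finite_allI) auto
  then show ?thesis by eventually_elim (simp add: vec_eq_iff)
qed

context ideal_model
begin

lemma finite_measure_subalgebra_Y:
  "finite_measure_subalgebra M (vimage_algebra (space M) Y borel)"
proof
  show "subalgebra M (vimage_algebra (space M) Y borel)"
    unfolding subalgebra_def by (auto simp: sets_vimage_algebra2)
qed

text \<open>Each coordinate of the conditional expectation is measurable with respect to the sigma-algebra of \<open>Y\<close>
and hence factors through \<open>Y\<close>.\<close>
lemma cond_exp_given_exists: "\<exists>m. cond_exp_given M X Y m"
proof -
  let ?F = "vimage_algebra (space M) Y borel"
  have "\<forall>i. \<exists>g. g \<in> borel_measurable borel \<and>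
      (\<forall>\<omega>\<in>space M. real_cond_exp M ?F (\<lambda>\<omega>. X \<omega> $ i) \<omega> = g (Y \<omega>))"
  proof
    fix i
    show "\<exists>g. g \<in> borel_measurable borel \<and>
        (\<forall>\<omega>\<in>space M. real_cond_exp M ?F (\<lambda>\<omega>. X \<omega> $ i) \<omega> = g (Y \<omega>))"
      unfolding Bex_def[symmetric] by (rule real_factor_through_vimage_algebra) simp_all
  qed
  from choice[OF this] obtain g where g: "\<forall>i. g i \<in> borel_measurable borel \<and>
      (\<forall>\<omega>\<in>space M. real_cond_exp M ?F (\<lambda>\<omega>. X \<omega> $ i) \<omega> = g i (Y \<omega>))" by blast
  have gm: "g i \<in> borel_measurable borel" for i using g by blast
  have "(\<lambda>y. \<chi> i. g i y) \<in> borel_measurable borel"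
    by (subst borel_measurable_euclidean_space) (auto simp: gm Basis_vec_def inner_axis)
  then have "cond_exp_given M X Y (\<lambda>y. \<chi> i. g i y)"
    unfolding cond_exp_given_def
  proof (intro conjI allI AE_I2)
    fix i \<omega> assume "\<omega> \<in> space M"
    with g show "real_cond_exp M ?F (\<lambda>\<omega>. X \<omega> $ i) \<omega> = (\<chi> i. g i (Y \<omega>)) $ i"
      unfolding vec_lambda_beta by blast
  qed
  then show ?thesis by blast
qed

end

locale conditioned_ideal_model = ideal_model M X eps
  for M :: "'a measure" and X eps :: "'a \<Rightarrow> real^'n" +
  fixes m :: "real^'n \<Rightarrow> real^'n"
  assumes m: "cond_exp_given M X Y m"
begin

lemma m_measurable [measurable]: "m \<in> borel_measurable borel"
  using m by (simp add: cond_exp_given_def)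

abbreviation D :: "real^'n \<Rightarrow> real^'n" where "D \<equiv> \<lambda>y. y - m y"

sublocale sub: finite_measure_subalgebra M "vimage_algebra (space M) Y borel"
  by (rule finite_measure_subalgebra_Y)

lemma m_AE: "AE \<omega> in M. real_cond_exp M (vimage_algebra (space M) Y borel) (\<lambda>\<omega>. X \<omega> $ i) \<omega> = m (Y \<omega>) $ i"
  using m by (simp add: cond_exp_given_def)

text \<open>By Jensen's inequality for conditional expectations, coordinatewise.\<close>
lemma m_square: "integrable M (\<lambda>\<omega>. (norm (m (Y \<omega>)))\<^sup>2)"
proof -
  let ?F = "vimage_algebra (space M) Y borel"
  have "integrable M (\<lambda>\<omega>. (m (Y \<omega>) $ i)\<^sup>2)" for i
  proof -
    have X2: "integrable M (\<lambda>\<omega>. (X \<omega> $ i)\<^sup>2)" using X_square by (simp add: integrable_norm_square_iff)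
    have X1: "integrable M (\<lambda>\<omega>. X \<omega> $ i)" by (rule square_integrable_imp_integrable[OF _ X2]) simp
    have "AE \<omega> in M. (real_cond_exp M ?F (\<lambda>\<omega>. X \<omega> $ i) \<omega>)\<^sup>2 \<le> real_cond_exp M ?F (\<lambda>\<omega>. (X \<omega> $ i)\<^sup>2) \<omega>"
      by (rule sub.real_cond_exp_jensens_inequality(2)[where I = UNIV])
        (use X1 X2 convex_power2 in auto)
    then have le: "AE \<omega> in M. norm ((m (Y \<omega>) $ i)\<^sup>2) \<le> norm (real_cond_exp M ?F (\<lambda>\<omega>. (X \<omega> $ i)\<^sup>2) \<omega>)"
      using m_AE[of i] by eventually_elim simp
    show ?thesis
      by (rule Bochner_Integration.integrable_bound[OF sub.real_cond_exp_int(1)[OF X2] _ le]) simp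
  qed
  then show ?thesis by (simp add: integrable_norm_square_iff)
qed

lemma D_square: "integrable M (\<lambda>\<omega>. (norm (D (Y \<omega>)))\<^sup>2)"
  by (rule integrable_norm_square_diff) (simp_all add: Y_square m_square)

lemma integral_mult_m:
  assumes [measurable]: "h \<in> borel_measurable borel" and h: "integrable M (\<lambda>\<omega>. (h (Y \<omega>))\<^sup>2)"
  shows "(\<integral>\<omega>. X \<omega> $ i * h (Y \<omega>) \<partial>M) = (\<integral>\<omega>. m (Y \<omega>) $ i * h (Y \<omega>) \<partial>M)"
proof -
  let ?F = "vimage_algebra (space M) Y borel"
  have hF: "(\<lambda>\<omega>. h (Y \<omega>)) \<in> borel_measurable ?F"
    by (rule measurable_compose[OF measurable_vimage_algebra1]) auto
  have "integrable M (\<lambda>\<omega>. h (Y \<omega>) * X \<omega> $ i)"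
    using h X_square by (intro integrable_mult_of_squares) (auto simp: integrable_norm_square_iff)
  then have "(\<integral>\<omega>. h (Y \<omega>) * real_cond_exp M ?F (\<lambda>\<omega>. X \<omega> $ i) \<omega> \<partial>M) = (\<integral>\<omega>. h (Y \<omega>) * X \<omega> $ i \<partial>M)"
    by (rule sub.real_cond_exp_intg(2)[OF _ hF]) simp
  moreover have "(\<integral>\<omega>. h (Y \<omega>) * real_cond_exp M ?F (\<lambda>\<omega>. X \<omega> $ i) \<omega> \<partial>M) = (\<integral>\<omega>. h (Y \<omega>) * m (Y \<omega>) $ i \<partial>M)"
    by (rule integral_cong_AE) (use m_AE[of i] in auto)
  ultimately show ?thesis by (simp add: mult.commute)
qed

text \<open>\<open>eps - D Y\<close> equals \<open>m Y - X\<close>, which is orthogonal to all square-integrable functions of \<open>Y\<close>; thus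
\<open>D Y\<close> is the projection of \<open>eps\<close> onto these.\<close>
lemma eps_minus_D_orthogonal:
  assumes [measurable]: "h \<in> borel_measurable borel" and h: "integrable M (\<lambda>\<omega>. (norm (h (Y \<omega>)))\<^sup>2)"
  shows "(\<integral>\<omega>. (eps \<omega> - D (Y \<omega>)) \<bullet> h (Y \<omega>) \<partial>M) = 0"
proof -
  have hi: "integrable M (\<lambda>\<omega>. (h (Y \<omega>) $ i)\<^sup>2)" for i using h by (simp add: integrable_norm_square_iff)
  have IX: "integrable M (\<lambda>\<omega>. X \<omega> $ i * h (Y \<omega>) $ i)"
    and Im: "integrable M (\<lambda>\<omega>. m (Y \<omega>) $ i * h (Y \<omega>) $ i)" for i
    using X_square m_square hi by (auto intro!: integrable_mult_of_squares simp: integrable_norm_square_iff)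
  have "(\<integral>\<omega>. (eps \<omega> - D (Y \<omega>)) \<bullet> h (Y \<omega>) \<partial>M) =
      (\<integral>\<omega>. (\<Sum>i\<in>UNIV. m (Y \<omega>) $ i * h (Y \<omega>) $ i - X \<omega> $ i * h (Y \<omega>) $ i) \<partial>M)"
    by (simp add: inner_vec_def algebra_simps)
  also have "\<dots> = (\<Sum>i\<in>UNIV. (\<integral>\<omega>. m (Y \<omega>) $ i * h (Y \<omega>) $ i \<partial>M) - (\<integral>\<omega>. X \<omega> $ i * h (Y \<omega>) $ i \<partial>M))"
    using IX Im by simp
  also have "\<dots> = 0" using integral_mult_m[OF _ hi] by simp
  finally show ?thesis .
qed

text \<open>The integrals are extended nonnegative ones because a competing procedure may have infinite risk:
if \<open>g Y\<close> is not square integrable, both sides are infinite, while otherwise the mixed term vanishes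
by orthogonality.\<close>
lemma nn_integral_pythagoras:
  assumes [measurable]: "g \<in> borel_measurable borel"
  shows "(\<integral>\<^sup>+\<omega>. ennreal ((norm (eps \<omega> - g (Y \<omega>)))\<^sup>2) \<partial>M) =
    (\<integral>\<^sup>+\<omega>. ennreal ((norm (eps \<omega> - D (Y \<omega>)))\<^sup>2) \<partial>M) +
    (\<integral>\<^sup>+\<omega>. ennreal ((norm (D (Y \<omega>) - g (Y \<omega>)))\<^sup>2) \<partial>M)"
proof (cases "integrable M (\<lambda>\<omega>. (norm (g (Y \<omega>)))\<^sup>2)")
  case True
  have IeD: "integrable M (\<lambda>\<omega>. (norm (eps \<omega> - D (Y \<omega>)))\<^sup>2)"
    and IDg: "integrable M (\<lambda>\<omega>. (norm (D (Y \<omega>) - g (Y \<omega>)))\<^sup>2)"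
    and Ieg: "integrable M (\<lambda>\<omega>. (norm (eps \<omega> - g (Y \<omega>)))\<^sup>2)"
    by (rule integrable_norm_square_diff[OF _ _ eps_square D_square]
        integrable_norm_square_diff[OF _ _ D_square True]
        integrable_norm_square_diff[OF _ _ eps_square True]; measurable)+
  have I: "integrable M (\<lambda>\<omega>. (eps \<omega> - D (Y \<omega>)) \<bullet> (D (Y \<omega>) - g (Y \<omega>)))"
    by (rule integrable_inner_of_squares) (use IeD IDg in auto)
  have z: "(\<integral>\<omega>. (eps \<omega> - D (Y \<omega>)) \<bullet> (D (Y \<omega>) - g (Y \<omega>)) \<partial>M) = 0"
    using eps_minus_D_orthogonal[of "\<lambda>y. D y - g y"] IDg by simp
  have eq: "(norm (eps \<omega> - g (Y \<omega>)))\<^sup>2 = (norm (eps \<omega> - D (Y \<omega>)))\<^sup>2 + (norm (D (Y \<omega>) - g (Y \<omega>)))\<^sup>2 +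
      2 * ((eps \<omega> - D (Y \<omega>)) \<bullet> (D (Y \<omega>) - g (Y \<omega>)))" for \<omega>
    by (simp add: power2_norm_eq_inner inner_diff_left inner_diff_right inner_add_left inner_add_right inner_commute)
  have "(\<integral>\<omega>. (norm (eps \<omega> - g (Y \<omega>)))\<^sup>2 \<partial>M) =
      (\<integral>\<omega>. (norm (eps \<omega> - D (Y \<omega>)))\<^sup>2 \<partial>M) + (\<integral>\<omega>. (norm (D (Y \<omega>) - g (Y \<omega>)))\<^sup>2 \<partial>M)"
    unfolding eq using IeD IDg I z by simp
  then show ?thesis
    using IeD IDg Ieg by (simp add: nn_integral_eq_integral)
next
  case False
  have infinite: "(\<integral>\<^sup>+\<omega>. ennreal ((norm (Z \<omega> - g (Y \<omega>)))\<^sup>2) \<partial>M) = \<infinity>"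
    if [measurable]: "Z \<in> borel_measurable M" and Z: "integrable M (\<lambda>\<omega>. (norm (Z \<omega>))\<^sup>2)"
    for Z :: "'a \<Rightarrow> real^'n"
  proof (rule ccontr)
    assume "\<not> ?thesis"
    then have I: "integrable M (\<lambda>\<omega>. (norm (Z \<omega> - g (Y \<omega>)))\<^sup>2)"
      by (intro integrableI_nonneg) (auto simp: less_top)
    have "integrable M (\<lambda>\<omega>. (norm (Z \<omega> - (Z \<omega> - g (Y \<omega>))))\<^sup>2)"
      by (rule integrable_norm_square_diff[OF _ _ Z I]) measurable
    then show False using False by simp
  qed
  show ?thesis using infinite[of eps] infinite[of "\<lambda>\<omega>. D (Y \<omega>)"] eps_square D_square by simp
qed

text \<open>If \<open>D Y = 0\<close> almost surely, then \<open>eps\<close> is orthogonal to \<open>Y = X + eps\<close>. Being centred and independent of \<open>X\<close>,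
it is orthogonal to \<open>X\<close> and hence to itself.\<close>
lemma D_not_null:
  assumes "\<not> (AE \<omega> in M. eps \<omega> = 0)"
  shows "(\<integral>\<omega>. norm (D (Y \<omega>)) \<partial>M) > 0"
proof (rule ccontr)
  assume neg: "\<not> ?thesis"
  have ID: "integrable M (\<lambda>\<omega>. norm (D (Y \<omega>)))"
    using integrable_if_norm_square[of "\<lambda>\<omega>. D (Y \<omega>)"] D_square by (intro integrable_norm) simp
  have "0 \<le> (\<integral>\<omega>. norm (D (Y \<omega>)) \<partial>M)" by (rule Bochner_Integration.integral_nonneg) simp
  with neg have "(\<integral>\<omega>. norm (D (Y \<omega>)) \<partial>M) = 0" by linarith
  then have D0: "AE \<omega> in M. D (Y \<omega>) = 0"
    using integral_nonneg_eq_0_iff_AE[OF ID] by simp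
  have IXe: "integrable M (\<lambda>\<omega>. X \<omega> $ i * eps \<omega> $ i)" for i
    using X_square eps_square by (auto intro!: integrable_mult_of_squares simp: integrable_norm_square_iff)
  have "(\<integral>\<omega>. X \<omega> \<bullet> eps \<omega> \<partial>M) = 0" unfolding inner_vec_def using IXe integral_X_eps by simp
  moreover have "(\<integral>\<omega>. (eps \<omega> - D (Y \<omega>)) \<bullet> Y \<omega> \<partial>M) = 0"
    using eps_minus_D_orthogonal[of "\<lambda>y. y"] Y_square by simp
  moreover have "(\<integral>\<omega>. (eps \<omega> - D (Y \<omega>)) \<bullet> Y \<omega> \<partial>M) = (\<integral>\<omega>. X \<omega> \<bullet> eps \<omega> + (norm (eps \<omega>))\<^sup>2 \<partial>M)"
    by (rule integral_cong_AE) (use D0 in \<open>auto simp: power2_norm_eq_inner inner_add_right inner_commute\<close>)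
  moreover have "integrable M (\<lambda>\<omega>. X \<omega> \<bullet> eps \<omega>)"
    using X_square eps_square by (intro integrable_inner_of_squares) auto
  ultimately have "(\<integral>\<omega>. (norm (eps \<omega>))\<^sup>2 \<partial>M) = 0" using eps_square by simp
  then have "AE \<omega> in M. eps \<omega> = 0"
    using integral_nonneg_eq_0_iff_AE[OF eps_square] by simp
  then show False using assms by simp
qed

end

section \<open>The saddle-point\<close>

lemma norm_clipped:
  fixes d :: "real^'n"
  assumes "\<rho> > 0"
  shows "norm (clip_factor \<rho> d *\<^sub>R d) = min (norm d) \<rho>"
  using assms by (auto simp: clip_factor_def min_def field_simps)

text \<open>For \<open>norm d \<le> \<rho>\<close> the penalty weight is \<open>0\<close> and \<open>c = d\<close>. Otherwise put \<open>k = norm d / \<rho>\<close>: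
the weight is \<open>k - 1\<close>, the quadratic has leading coefficient \<open>k\<close> and minimizer \<open>d / k\<close>, which is \<open>d\<close>
clipped at \<open>\<rho>\<close>, and completing the square shows the excess to be \<open>k * (norm (g - c))\<^sup>2\<close>.\<close>
lemma clipped_minimizes_penalized_distance:
  fixes d g :: "real^'n"
  assumes "\<rho> > 0"
  defines "w \<equiv> max (norm d / \<rho> - 1) 0" and "c \<equiv> clip_factor \<rho> d *\<^sub>R d"
  shows "(norm (d - c))\<^sup>2 + w * (norm c)\<^sup>2 \<le> (norm (d - g))\<^sup>2 + w * (norm g)\<^sup>2"
proof (cases "norm d \<le> \<rho>")
  case True
  then have "c = d" "w = 0" using assms by (auto simp: c_def w_def clip_factor_def min_def)
  then show ?thesis by simp
next
  case False
  define k where "k = norm d / \<rho>"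
  have k: "k > 1" using False \<open>\<rho> > 0\<close> by (simp add: k_def)
  have w: "w = k - 1" using k by (simp add: w_def k_def)
  have d: "d \<noteq> 0" using False \<open>\<rho> > 0\<close> by auto
  have c: "c = (1 / k) *\<^sub>R d"
    using False d \<open>\<rho> > 0\<close> by (simp add: c_def clip_factor_def k_def min_def field_simps)
  have dk: "d = k *\<^sub>R c" using k c by simp
  have "(norm (d - g))\<^sup>2 + w * (norm g)\<^sup>2 - ((norm (d - c))\<^sup>2 + w * (norm c)\<^sup>2) = k * (norm (g - c))\<^sup>2"
    unfolding w dk power2_norm_eq_inner
    by (simp add: inner_diff_left inner_diff_right inner_commute algebra_simps)
  moreover have "0 \<le> k * (norm (g - c))\<^sup>2" using k by simp
  ultimately show ?thesis by linarith
qed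

lemma borel_measurable_clip_factor [measurable]: "clip_factor \<rho> \<in> borel_measurable borel"
  unfolding clip_factor_def[abs_def] by measurable

lemma rls_io_residual: "y - rls_io m \<rho> y = clip_factor \<rho> (y - m y) *\<^sub>R (y - m y)"
  by (simp add: rls_io_def)

context conditioned_ideal_model
begin

lemma rls_io_measurable [measurable]: "rls_io m \<rho> \<in> borel_measurable borel"
  unfolding rls_io_def[abs_def] by measurable

lemma sets_least_favorable [simp, measurable_cong]:
  "sets (least_favorable (distr M borel Y) m r \<rho>) = sets borel"
  by (simp add: least_favorable_def)

lemma nn_integral_least_favorable:
  assumes [measurable]: "k \<in> borel_measurable borel"
  shows "(\<integral>\<^sup>+y. k y \<partial>least_favorable (distr M borel Y) m r \<rho>) =
    (\<integral>\<^sup>+\<omega>. ennreal ((1 - r) / r * max (norm (D (Y \<omega>)) / \<rho> - 1) 0) * k (Y \<omega>) \<partial>M)"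
  unfolding least_favorable_def
  by (subst nn_integral_density) (simp_all add: nn_integral_distr)

text \<open>The density vanishes where \<open>norm (D y) \<le> \<rho>\<close>; elsewhere clipping brings the residual to length exactly \<open>\<rho>\<close>.\<close>
lemma AE_least_favorable:
  assumes "\<rho> > 0"
  shows "AE y in least_favorable (distr M borel Y) m r \<rho>. norm (y - rls_io m \<rho> y) = \<rho>"
proof -
  have zero: "max (norm (D y) / \<rho> - 1) 0 = 0" if "norm (y - rls_io m \<rho> y) \<noteq> \<rho>" for y
  proof -
    have "norm (D y) \<le> \<rho>"
      using that norm_clipped[OF assms, of "D y"] unfolding rls_io_residual by (auto simp: min_def split: if_splits)
    then show ?thesis using assms by (simp add: max_def)
  qed
  show ?thesis
    unfolding least_favorable_def
  proof (subst AE_density)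
    show "AE y in distr M borel Y. 0 < ennreal ((1 - r) / r * max (norm (D y) / \<rho> - 1) 0) \<longrightarrow>
        norm (y - rls_io m \<rho> y) = \<rho>"
    proof (intro AE_I2 impI, rule ccontr)
      fix y assume "0 < ennreal ((1 - r) / r * max (norm (D y) / \<rho> - 1) 0)" and "norm (y - rls_io m \<rho> y) \<noteq> \<rho>"
      then show False by (simp add: zero)
    qed
  qed measurable
qed

text \<open>\<open>E f\<close> below is the ideal part of the risk of \<open>f\<close>, and \<open>e = E|eps|^2\<close>. For the first
inequality, \<open>max\<close>, the risk of \<open>rls_io m \<rho>\<close> is at most the convex combination of \<open>E (rls_io m \<rho>)\<close>
and \<open>e + \<rho>\<^sup>2\<close> with weights \<open>1 - s\<close> and \<open>s\<close>, with equality at \<open>(r, G)\<close>, and the second of these values is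
the larger one. For the second inequality, \<open>min\<close>, the functional \<open>J\<close> collects the part of the risk at
\<open>(r, G)\<close> that depends on the procedure; it is minimized pointwise.\<close>
theorem io_saddle_point_least_favorable:
  assumes r: "0 < r" "r < 1" and \<rho>: "\<rho> > 0"
    and one: "emeasure (least_favorable (distr M borel Y) m r \<rho>) UNIV = 1"
  shows "io_saddle_point M X eps r (rls_io m \<rho>) (least_favorable (distr M borel Y) m r \<rho>)"
proof -
  define G where "G = least_favorable (distr M borel Y) m r \<rho>"
  define E where "E f = (\<integral>\<^sup>+\<omega>. ennreal ((norm (eps \<omega> - (Y \<omega> - f (Y \<omega>))))\<^sup>2) \<partial>M)" for f
  define e where "e = (\<integral>\<^sup>+\<omega>. ennreal ((norm (eps \<omega>))\<^sup>2) \<partial>M)"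
  have sets_G [measurable_cong]: "sets G = sets borel" by (simp add: G_def)
  have space_G: "space G = UNIV" using sets_eq_imp_space_eq[OF sets_G] by simp
  interpret G: prob_space G
    by (rule prob_spaceI) (use one in \<open>simp add: G_def[symmetric] space_G\<close>)
  have e_fin: "e \<noteq> \<top>" using eps_square by (simp add: e_def nn_integral_eq_integral)
  have risk: "io_risk P f = ennreal (1 - s) * E f +
      ennreal s * (\<integral>\<^sup>+y. e + ennreal ((norm (y - f y))\<^sup>2) \<partial>G')"
    if "io_law M X eps s G' P" "0 \<le> s" "s \<le> 1" "f \<in> borel_measurable borel" for s G' P f
    unfolding E_def e_def by (rule io_risk_eq[OF that])
  have E_le: "E (rls_io m \<rho>) \<le> e"
  proof -
    have "E (rls_io m \<rho>) = (\<integral>\<^sup>+\<omega>. ennreal ((norm (eps \<omega> - D (Y \<omega>)))\<^sup>2) \<partial>M) +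
        (\<integral>\<^sup>+\<omega>. ennreal ((norm (D (Y \<omega>) - (Y \<omega> - rls_io m \<rho> (Y \<omega>))))\<^sup>2) \<partial>M)"
      unfolding E_def by (rule nn_integral_pythagoras) measurable
    also have "\<dots> \<le> (\<integral>\<^sup>+\<omega>. ennreal ((norm (eps \<omega> - D (Y \<omega>)))\<^sup>2) \<partial>M) +
        (\<integral>\<^sup>+\<omega>. ennreal ((norm (D (Y \<omega>) - 0))\<^sup>2) \<partial>M)"
    proof (intro add_left_mono nn_integral_mono ennreal_leI power_mono)
      fix \<omega>
      show "norm (D (Y \<omega>) - (Y \<omega> - rls_io m \<rho> (Y \<omega>))) \<le> norm (D (Y \<omega>) - 0)"
      proof -
        let ?d = "D (Y \<omega>)"
        have c: "0 \<le> clip_factor \<rho> ?d" "clip_factor \<rho> ?d \<le> 1"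
          using \<rho> by (auto simp: clip_factor_def)
        have "?d - (Y \<omega> - rls_io m \<rho> (Y \<omega>)) = (1 - clip_factor \<rho> ?d) *\<^sub>R ?d"
          unfolding rls_io_residual by (simp only: scaleR_left_diff_distrib scaleR_one)
        then have "norm (?d - (Y \<omega> - rls_io m \<rho> (Y \<omega>))) = (1 - clip_factor \<rho> ?d) * norm ?d"
          using c by simp
        also have "\<dots> \<le> norm ?d" using c by (intro mult_left_le_one_le) auto
        finally show ?thesis by simp
      qed
    qed simp
    \<comment> \<open>Pythagoras again, now read backwards for the residual \<open>0\<close>.\<close>
    also have "\<dots> = (\<integral>\<^sup>+\<omega>. ennreal ((norm (eps \<omega> - 0))\<^sup>2) \<partial>M)"
      by (rule nn_integral_pythagoras[symmetric]) measurable
    finally show ?thesis by (simp add: e_def)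
  qed
  have mean1: "(\<integral>\<^sup>+y. e + ennreal ((norm (y - rls_io m \<rho> y))\<^sup>2) \<partial>G) = e + ennreal (\<rho>\<^sup>2)"
  proof -
    have "(\<integral>\<^sup>+y. e + ennreal ((norm (y - rls_io m \<rho> y))\<^sup>2) \<partial>G) = (\<integral>\<^sup>+y. e + ennreal (\<rho>\<^sup>2) \<partial>G)"
      using AE_least_favorable[OF \<rho>, of r, folded G_def]
      by (intro nn_integral_cong_AE, eventually_elim) simp
    then show ?thesis by (simp add: G.emeasure_space_1)
  qed
  have max: "io_risk P (rls_io m \<rho>) \<le> io_risk P1 (rls_io m \<rho>)"
    if P1: "io_law M X eps r G P1" and P: "P \<in> io_neighborhood M X eps r" for P P1
  proof -
    obtain s G' where s: "0 \<le> s" "s \<le> r" and law: "io_law M X eps s G' P"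
      using P by (auto simp: io_neighborhood_def io_sphere_def)
    interpret G': prob_space G'
    proof -
      obtain N :: "(nat \<times> (real^'n) \<times> (real^'n) \<times> (real^'n)) measure" and X' eps' U Ydi
        where io: "io_model M X eps s N X' eps' U Ydi" and G': "G' = distr N borel Ydi"
        using law unfolding io_law_def by auto
      interpret N: prob_space N using io by (simp add: io_model_def)
      have "N.indep_var borel eps' borel Ydi" using io by (auto simp: io_model_def)
      then show "prob_space G'" unfolding G' by (rule N.prob_space_distr[OF N.indep_var_rv2])
    qed
    have "(\<integral>\<^sup>+y. e + ennreal ((norm (y - rls_io m \<rho> y))\<^sup>2) \<partial>G') \<le> (\<integral>\<^sup>+y. e + ennreal (\<rho>\<^sup>2) \<partial>G')"
      unfolding rls_io_residual norm_clipped[OF \<rho>]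
      using \<rho> by (intro nn_integral_mono add_left_mono ennreal_leI power_mono) auto
    also have "\<dots> = e + ennreal (\<rho>\<^sup>2)" by (simp add: G'.emeasure_space_1)
    finally have le: "(\<integral>\<^sup>+y. e + ennreal ((norm (y - rls_io m \<rho> y))\<^sup>2) \<partial>G') \<le> e + ennreal (\<rho>\<^sup>2)" .
    obtain b where b: "e = ennreal b" "0 \<le> b" using e_fin by (cases e) auto
    then have "E (rls_io m \<rho>) \<noteq> \<top>" using E_le by (auto simp: top_unique)
    then obtain a where a: "E (rls_io m \<rho>) = ennreal a" "0 \<le> a" by (cases "E (rls_io m \<rho>)") auto
    have ab: "a \<le> b" using E_le a b by simp
    have "io_risk P (rls_io m \<rho>) \<le> ennreal (1 - s) * E (rls_io m \<rho>) + ennreal s * (e + ennreal (\<rho>\<^sup>2))"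
      using risk[OF law s(1)] s r le by (auto intro!: add_left_mono mult_left_mono)
    also have "\<dots> = ennreal ((1 - s) * a + s * (b + \<rho>\<^sup>2))"
      using a b s r by (simp add: ennreal_mult ennreal_plus)
    also have "\<dots> \<le> ennreal ((1 - r) * a + r * (b + \<rho>\<^sup>2))"
    proof (rule ennreal_leI)
      have "0 \<le> (r - s) * ((b + \<rho>\<^sup>2) - a)" using ab s add_increasing2[of "\<rho>\<^sup>2" a b] by (intro mult_nonneg_nonneg) simp_all
      then show "(1 - s) * a + s * (b + \<rho>\<^sup>2) \<le> (1 - r) * a + r * (b + \<rho>\<^sup>2)"
        by (simp add: algebra_simps)
    qed
    also have "\<dots> = ennreal (1 - r) * E (rls_io m \<rho>) + ennreal r * (e + ennreal (\<rho>\<^sup>2))"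
      using a b r by (simp add: ennreal_mult ennreal_plus)
    also have "\<dots> = io_risk P1 (rls_io m \<rho>)"
      using risk[OF P1, of "rls_io m \<rho>"] r mean1 by simp
    finally show ?thesis .
  qed
  have min: "io_risk P1 (rls_io m \<rho>) \<le> io_risk P1 f"
    if P1: "io_law M X eps r G P1" and f [measurable]: "f \<in> borel_measurable borel" for P1 f
  proof -
    define w where "w y = max (norm (D y) / \<rho> - 1) 0" for y
    define J where "J f = (\<integral>\<^sup>+\<omega>. ennreal ((norm (D (Y \<omega>) - (Y \<omega> - f (Y \<omega>))))\<^sup>2 +
        w (Y \<omega>) * (norm (Y \<omega> - f (Y \<omega>)))\<^sup>2) \<partial>M)" for f
    have [measurable]: "w \<in> borel_measurable borel" unfolding w_def by measurable
    have J: "io_risk P1 f = ennreal (1 - r) * ((\<integral>\<^sup>+\<omega>. ennreal ((norm (eps \<omega> - D (Y \<omega>)))\<^sup>2) \<partial>M) + J f) +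
        ennreal r * e" if [measurable]: "f \<in> borel_measurable borel" for f
    proof -
      have w0: "0 \<le> w y" for y by (simp add: w_def)
      \<comment> \<open>The factor \<open>(1 - r) / r\<close> in the density turns the weight \<open>r\<close> of the contamination into \<open>1 - r\<close>.\<close>
      have rc: "r * ((1 - r) / r * w y) = (1 - r) * w y" for y using r by simp
      have "(\<integral>\<^sup>+y. e + ennreal ((norm (y - f y))\<^sup>2) \<partial>G) = e + (\<integral>\<^sup>+y. ennreal ((norm (y - f y))\<^sup>2) \<partial>G)"
        by (subst nn_integral_add) (simp_all add: G.emeasure_space_1)
      also have "(\<integral>\<^sup>+y. ennreal ((norm (y - f y))\<^sup>2) \<partial>G) =
          (\<integral>\<^sup>+\<omega>. ennreal ((1 - r) / r * w (Y \<omega>)) * ennreal ((norm (Y \<omega> - f (Y \<omega>)))\<^sup>2) \<partial>M)"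
        unfolding G_def w_def by (rule nn_integral_least_favorable) measurable
      finally have G: "ennreal r * (\<integral>\<^sup>+y. e + ennreal ((norm (y - f y))\<^sup>2) \<partial>G) = ennreal r * e +
          ennreal r * (\<integral>\<^sup>+\<omega>. ennreal ((1 - r) / r * w (Y \<omega>)) * ennreal ((norm (Y \<omega> - f (Y \<omega>)))\<^sup>2) \<partial>M)"
        by (simp add: distrib_left)
      have "ennreal r * (\<integral>\<^sup>+\<omega>. ennreal ((1 - r) / r * w (Y \<omega>)) * ennreal ((norm (Y \<omega> - f (Y \<omega>)))\<^sup>2) \<partial>M) =
          (\<integral>\<^sup>+\<omega>. ennreal r * (ennreal ((1 - r) / r * w (Y \<omega>)) * ennreal ((norm (Y \<omega> - f (Y \<omega>)))\<^sup>2)) \<partial>M)"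
        by (rule nn_integral_cmult[symmetric]) measurable
      also have "\<dots> = (\<integral>\<^sup>+\<omega>. ennreal (1 - r) * ennreal (w (Y \<omega>) * (norm (Y \<omega> - f (Y \<omega>)))\<^sup>2) \<partial>M)"
        using r w0 rc by (intro nn_integral_cong) (simp add: ennreal_mult[symmetric] mult.assoc[symmetric])
      also have "\<dots> = ennreal (1 - r) * (\<integral>\<^sup>+\<omega>. ennreal (w (Y \<omega>) * (norm (Y \<omega> - f (Y \<omega>)))\<^sup>2) \<partial>M)"
        by (rule nn_integral_cmult) measurable
      finally have W: "ennreal r * (\<integral>\<^sup>+\<omega>. ennreal ((1 - r) / r * w (Y \<omega>)) * ennreal ((norm (Y \<omega> - f (Y \<omega>)))\<^sup>2) \<partial>M) =
          ennreal (1 - r) * (\<integral>\<^sup>+\<omega>. ennreal (w (Y \<omega>) * (norm (Y \<omega> - f (Y \<omega>)))\<^sup>2) \<partial>M)" .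
      have E: "E f = (\<integral>\<^sup>+\<omega>. ennreal ((norm (eps \<omega> - D (Y \<omega>)))\<^sup>2) \<partial>M) +
          (\<integral>\<^sup>+\<omega>. ennreal ((norm (D (Y \<omega>) - (Y \<omega> - f (Y \<omega>))))\<^sup>2) \<partial>M)"
        unfolding E_def by (rule nn_integral_pythagoras) measurable
      have Jf: "J f = (\<integral>\<^sup>+\<omega>. ennreal ((norm (D (Y \<omega>) - (Y \<omega> - f (Y \<omega>))))\<^sup>2) \<partial>M) +
          (\<integral>\<^sup>+\<omega>. ennreal (w (Y \<omega>) * (norm (Y \<omega> - f (Y \<omega>)))\<^sup>2) \<partial>M)"
      proof -
        have "J f = (\<integral>\<^sup>+\<omega>. ennreal ((norm (D (Y \<omega>) - (Y \<omega> - f (Y \<omega>))))\<^sup>2) +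
          ennreal (w (Y \<omega>) * (norm (Y \<omega> - f (Y \<omega>)))\<^sup>2) \<partial>M)"
          unfolding J_def using w0 by (intro nn_integral_cong ennreal_plus) auto
        also have "\<dots> = (\<integral>\<^sup>+\<omega>. ennreal ((norm (D (Y \<omega>) - (Y \<omega> - f (Y \<omega>))))\<^sup>2) \<partial>M) +
          (\<integral>\<^sup>+\<omega>. ennreal (w (Y \<omega>) * (norm (Y \<omega> - f (Y \<omega>)))\<^sup>2) \<partial>M)"
          by (rule nn_integral_add; measurable)
        finally show ?thesis .
      qed
      have "io_risk P1 f = ennreal (1 - r) * E f +
          ennreal r * (\<integral>\<^sup>+y. e + ennreal ((norm (y - f y))\<^sup>2) \<partial>G)"
        by (rule risk[OF P1]) (use r in auto)
      then show ?thesis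
        unfolding G W E Jf by (simp only: distrib_left ac_simps)
    qed
    have "J (rls_io m \<rho>) \<le> J f"
      unfolding J_def w_def
    proof (intro nn_integral_mono ennreal_leI)
      fix \<omega>
      let ?y = "Y \<omega>"
      show "(norm (D ?y - (?y - rls_io m \<rho> ?y)))\<^sup>2 + max (norm (D ?y) / \<rho> - 1) 0 * (norm (?y - rls_io m \<rho> ?y))\<^sup>2
          \<le> (norm (D ?y - (?y - f ?y)))\<^sup>2 + max (norm (D ?y) / \<rho> - 1) 0 * (norm (?y - f ?y))\<^sup>2"
        unfolding rls_io_residual by (rule clipped_minimizes_penalized_distance[OF \<rho>])
    qed
    then show ?thesis
      unfolding J[OF f] J[OF rls_io_measurable] by (intro add_mono mult_left_mono) auto
  qed
  have "\<exists>P1. io_law M X eps r G P1"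
    by (rule io_law_exists) (use r sets_G G.prob_space_axioms in auto)
  then show ?thesis
    unfolding io_saddle_point_def G_def[symmetric] using max min rls_io_measurable by blast
qed

text \<open>With \<open>d = norm (D Y)\<close> the mass of the measure is \<open>E (d - \<rho>)_+ / (\<kappa> * \<rho>)\<close>, where
\<open>\<kappa> = r / (1 - r)\<close>. The function \<open>\<phi> t = E (d - t)_+\<close> is 1-Lipschitz, so \<open>\<phi> t - \<kappa> * t\<close> is continuous; it
equals \<open>E d > 0\<close> at \<open>t = 0\<close>, and is at most \<open>0\<close> at \<open>t = E d / \<kappa>\<close> since \<open>\<phi> \<le> E d\<close> there.\<close>
theorem clipping_height_exists:
  assumes r: "0 < r" "r < 1" and "\<not> (AE \<omega> in M. eps \<omega> = 0)"
  shows "\<exists>\<rho>>0. emeasure (least_favorable (distr M borel Y) m r \<rho>) UNIV = 1"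
proof -
  define d where "d \<omega> = norm (D (Y \<omega>))" for \<omega>
  have [measurable]: "d \<in> borel_measurable M" unfolding d_def by measurable
  have d: "integrable M d"
    unfolding d_def using integrable_if_norm_square[of "\<lambda>\<omega>. D (Y \<omega>)"] D_square
    by (intro integrable_norm) simp
  have pos: "0 < (\<integral>\<omega>. d \<omega> \<partial>M)" unfolding d_def by (rule D_not_null) fact
  define \<phi> where "\<phi> t = (\<integral>\<omega>. max (d \<omega> - t) 0 \<partial>M)" for t
  have I: "integrable M (\<lambda>\<omega>. max (d \<omega> - t) 0)" for t using d by simp
  have lip: "\<bar>\<phi> s - \<phi> t\<bar> \<le> \<bar>s - t\<bar>" for s t
  proof -
    have "\<bar>\<phi> s - \<phi> t\<bar> = \<bar>\<integral>\<omega>. max (d \<omega> - s) 0 - max (d \<omega> - t) 0 \<partial>M\<bar>"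
      unfolding \<phi>_def using I by simp
    also have "\<dots> \<le> (\<integral>\<omega>. \<bar>max (d \<omega> - s) 0 - max (d \<omega> - t) 0\<bar> \<partial>M)" by (rule integral_abs_bound)
    also have "\<dots> \<le> (\<integral>\<omega>. \<bar>s - t\<bar> \<partial>M)" using I by (intro integral_mono) auto
    finally show ?thesis by (simp add: prob_space)
  qed
  then have "1-lipschitz_on UNIV \<phi>" by (auto simp: lipschitz_on_def dist_real_def)
  then have cont: "continuous_on UNIV \<phi>" by (rule lipschitz_on_continuous_on)
  define \<kappa> where "\<kappa> = r / (1 - r)"
  have \<kappa>: "\<kappa> > 0" using r by (simp add: \<kappa>_def)
  define b where "b = (\<integral>\<omega>. d \<omega> \<partial>M) / \<kappa>"
  have b: "b > 0" using pos \<kappa> by (simp add: b_def)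
  have "\<exists>x. 0 \<le> x \<and> x \<le> b \<and> \<phi> x - \<kappa> * x = 0"
  proof (rule IVT2')
    show "0 \<le> \<phi> 0 - \<kappa> * 0" unfolding \<phi>_def by simp
    have "\<phi> b \<le> (\<integral>\<omega>. d \<omega> \<partial>M)"
      unfolding \<phi>_def by (rule integral_mono[OF I d]) (use b in \<open>auto simp: d_def\<close>)
    then show "\<phi> b - \<kappa> * b \<le> 0" using \<kappa> by (simp add: b_def)
    show "continuous_on {0..b} (\<lambda>x. \<phi> x - \<kappa> * x)"
      by (intro continuous_intros continuous_on_subset[OF cont]) auto
  qed (use b in simp)
  then obtain \<rho> where \<rho>: "0 \<le> \<rho>" "\<phi> \<rho> = \<kappa> * \<rho>" by auto
  have "\<phi> 0 = (\<integral>\<omega>. d \<omega> \<partial>M)" unfolding \<phi>_def by (simp add: d_def max_absorb1)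
  then have "\<rho> \<noteq> 0" using \<rho> pos by auto
  with \<rho> have "\<rho> > 0" by simp
  have "emeasure (least_favorable (distr M borel Y) m r \<rho>) UNIV =
      (\<integral>\<^sup>+y. 1 \<partial>least_favorable (distr M borel Y) m r \<rho>)"
    by (simp add: least_favorable_def)
  also have "\<dots> = (\<integral>\<^sup>+\<omega>. ennreal ((1 - r) / r * max (d \<omega> / \<rho> - 1) 0) \<partial>M)"
    by (subst nn_integral_least_favorable) (simp_all add: d_def)
  also have "\<dots> = (\<integral>\<^sup>+\<omega>. ennreal ((1 / (\<kappa> * \<rho>)) * max (d \<omega> - \<rho>) 0) \<partial>M)"
  proof (intro nn_integral_cong arg_cong[where f = ennreal])
    fix \<omega>
    have "max (d \<omega> / \<rho> - 1) 0 = max (d \<omega> - \<rho>) 0 / \<rho>"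
      using \<open>\<rho> > 0\<close> by (auto simp: max_def field_simps)
    then show "(1 - r) / r * max (d \<omega> / \<rho> - 1) 0 = (1 / (\<kappa> * \<rho>)) * max (d \<omega> - \<rho>) 0"
      by (simp add: \<kappa>_def)
  qed
  also have "\<dots> = ennreal (\<integral>\<omega>. (1 / (\<kappa> * \<rho>)) * max (d \<omega> - \<rho>) 0 \<partial>M)"
    using I \<kappa> \<open>\<rho> > 0\<close> by (intro nn_integral_eq_integral) auto
  also have "(\<integral>\<omega>. (1 / (\<kappa> * \<rho>)) * max (d \<omega> - \<rho>) 0 \<partial>M) = 1"
    using \<rho> \<kappa> \<open>\<rho> > 0\<close> by (simp add: \<phi>_def[symmetric])
  finally show ?thesis using \<open>\<rho> > 0\<close> by auto
qed

end

section \<open>Linear conditional expectations and the Kalman gain\<close>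

context ideal_model
begin

lemma cov_matrix_X_Y: "cov_matrix M X Y = var_matrix M X"
proof -
  have XX: "integrable M (\<lambda>\<omega>. X \<omega> $ i * X \<omega> $ j)"
    and Xe: "integrable M (\<lambda>\<omega>. X \<omega> $ i * eps \<omega> $ j)" for i j
    using X_square eps_square by (auto intro!: integrable_mult_of_squares simp: integrable_norm_square_iff)
  have e0: "(\<integral>\<omega>. eps \<omega> $ j \<partial>M) = 0" for j
    using eps_mean integrable_eps by (simp add: integral_vec_nth[symmetric])
  show ?thesis
    using X_square eps_square Y_square
    by (simp add: vec_eq_iff cov_matrix_eq distrib_left XX Xe integral_X_eps e0
        integrable_vec_nth integrable_X integrable_eps)
qed

lemma var_matrix_Y: "var_matrix M Y = var_matrix M X + var_matrix M eps"
proof -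
  have XX: "integrable M (\<lambda>\<omega>. X \<omega> $ i * X \<omega> $ j)"
    and ee: "integrable M (\<lambda>\<omega>. eps \<omega> $ i * eps \<omega> $ j)"
    and Xe: "integrable M (\<lambda>\<omega>. X \<omega> $ i * eps \<omega> $ j)"
    and eX: "integrable M (\<lambda>\<omega>. eps \<omega> $ i * X \<omega> $ j)" for i j
    using X_square eps_square by (auto intro!: integrable_mult_of_squares simp: integrable_norm_square_iff)
  have eX0: "(\<integral>\<omega>. eps \<omega> $ i * X \<omega> $ j \<partial>M) = 0" for i j
    using integral_X_eps[of j i] by (simp add: mult.commute)
  have e0: "(\<integral>\<omega>. eps \<omega> $ j \<partial>M) = 0" for j
    using eps_mean integrable_eps by (simp add: integral_vec_nth[symmetric])
  show ?thesis
    using X_square eps_square Y_square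
    by (simp add: vec_eq_iff cov_matrix_eq distrib_left distrib_right XX Xe eX ee integral_X_eps eX0 e0
        integrable_vec_nth integrable_X integrable_eps)
qed

text \<open>\<open>X - A *v Y\<close> is orthogonal to the coordinates of \<open>Y\<close> and to constants.\<close>
lemma linear_cond_exp_normal_equation:
  assumes "cond_exp_given M X Y (\<lambda>y. A *v y)"
  shows "A ** var_matrix M Y = cov_matrix M X Y"
proof -
  interpret conditioned_ideal_model M X eps "\<lambda>y. A *v y" by unfold_locales (rule assms)
  have YY: "integrable M (\<lambda>\<omega>. Y \<omega> $ i * Y \<omega> $ j)" for i j
    by (rule integrable_mult_of_squares) (use Y_square in \<open>simp_all add: integrable_norm_square_iff del: vector_add_component\<close>)
  have Y1: "integrable M (\<lambda>\<omega>. Y \<omega> $ i)" for i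
    using integrable_X integrable_eps by (intro integrable_vec_nth) simp
  have XY: "(\<integral>\<omega>. X \<omega> $ i * Y \<omega> $ j \<partial>M) = (\<Sum>k\<in>UNIV. A $ i $ k * (\<integral>\<omega>. Y \<omega> $ k * Y \<omega> $ j \<partial>M))" for i j
  proof -
    have "(\<integral>\<omega>. X \<omega> $ i * Y \<omega> $ j \<partial>M) = (\<integral>\<omega>. (A *v Y \<omega>) $ i * Y \<omega> $ j \<partial>M)"
      by (rule integral_mult_m[where h = "\<lambda>y. y $ j"])
        (use Y_square in \<open>simp_all add: integrable_norm_square_iff del: vector_add_component\<close>)
    also have "\<dots> = (\<integral>\<omega>. (\<Sum>k\<in>UNIV. A $ i $ k * (Y \<omega> $ k * Y \<omega> $ j)) \<partial>M)"
      by (simp add: matrix_vector_mult_def sum_distrib_right mult.assoc del: vector_add_component)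
    also have "\<dots> = (\<Sum>k\<in>UNIV. A $ i $ k * (\<integral>\<omega>. Y \<omega> $ k * Y \<omega> $ j \<partial>M))"
      using YY by (simp del: vector_add_component)
    finally show ?thesis .
  qed
  have X: "(\<integral>\<omega>. X \<omega> $ i \<partial>M) = (\<Sum>k\<in>UNIV. A $ i $ k * (\<integral>\<omega>. Y \<omega> $ k \<partial>M))" for i
  proof -
    have "(\<integral>\<omega>. X \<omega> $ i \<partial>M) = (\<integral>\<omega>. (A *v Y \<omega>) $ i \<partial>M)"
      using integral_mult_m[of "\<lambda>_. 1" i] by simp
    also have "\<dots> = (\<integral>\<omega>. (\<Sum>k\<in>UNIV. A $ i $ k * Y \<omega> $ k) \<partial>M)"
      by (simp add: matrix_vector_mult_def del: vector_add_component)
    also have "\<dots> = (\<Sum>k\<in>UNIV. A $ i $ k * (\<integral>\<omega>. Y \<omega> $ k \<partial>M))"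
      using Y1 by (simp del: vector_add_component)
    finally show ?thesis .
  qed
  have "(A ** var_matrix M Y) $ i $ j = cov_matrix M X Y $ i $ j" for i j
    using X_square Y_square
    by (simp add: cov_matrix_eq matrix_matrix_mult_def XY X sum_distrib_right sum_subtractf right_diff_distrib
        mult.assoc del: vector_add_component)
  then show ?thesis by (simp add: vec_eq_iff)
qed

lemma linear_cond_exp_eq_gain_on_range:
  assumes A: "cond_exp_given M X Y (\<lambda>y. A *v y)" and v: "v \<in> range ((*v) (var_matrix M Y))"
  shows "A *v v = (cov_matrix M X Y ** moore_penrose_inverse (var_matrix M Y)) *v v"
proof -
  define V where "V = var_matrix M Y"
  obtain z where z: "v = V *v z" using v by (auto simp: V_def)
  have V: "V ** moore_penrose_inverse V ** V = V"
    by (rule mult_moore_penrose_inverse_mult_symmetric) (simp add: V_def transpose_var_matrix)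
  have "(cov_matrix M X Y ** moore_penrose_inverse V) *v v = (A ** (V ** moore_penrose_inverse V ** V)) *v z"
    using linear_cond_exp_normal_equation[OF A]
    by (simp add: z V_def[symmetric] matrix_vector_mul_assoc matrix_mul_assoc)
  also have "\<dots> = A *v v" by (simp add: V z matrix_vector_mul_assoc)
  finally show ?thesis by (simp add: V_def)
qed

lemma linear_cond_exp_eq_gain:
  assumes A: "cond_exp_given M X Y (\<lambda>y. A *v y)" and "invertible (var_matrix M Y)"
  shows "A = cov_matrix M X Y ** moore_penrose_inverse (var_matrix M Y)"
proof -
  have "surj ((*v) (var_matrix M Y))"
    using assms(2) by (metis invertible_right_inverse matrix_right_invertible_surjective)
  then show ?thesis
    using linear_cond_exp_eq_gain_on_range[OF A] by (simp add: matrix_eq)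
qed

text \<open>The means \<open>E X\<close> and \<open>E Y\<close> agree, so under the assumption on the mean both summands of
  \<open>Y = (Y - E Y) + E Y\<close> lie in the range of \<open>Var Y\<close>.\<close>
lemma linear_cond_exp_AE_eq_gain:
  assumes A: "cond_exp_given M X Y (\<lambda>y. A *v y)"
    and mean: "(\<integral>\<omega>. X \<omega> \<partial>M) \<in> range ((*v) (var_matrix M Y))"
  shows "AE \<omega> in M. A *v Y \<omega> = (cov_matrix M X Y ** moore_penrose_inverse (var_matrix M Y)) *v Y \<omega>"
proof -
  have EY: "(\<integral>\<omega>. Y \<omega> \<partial>M) = (\<integral>\<omega>. X \<omega> \<partial>M)"
    using integrable_X integrable_eps eps_mean by simp
  have sub: "subspace (range ((*v) (var_matrix M Y)))"
    by (simp add: linear_subspace_image)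
  have "AE \<omega> in M. Y \<omega> - (\<integral>\<omega>. X \<omega> \<partial>M) \<in> range ((*v) (var_matrix M Y))"
    using AE_centered_in_range_var_matrix[of Y] Y_square unfolding EY by simp
  then show ?thesis
  proof eventually_elim
    fix \<omega> assume "Y \<omega> - (\<integral>\<omega>. X \<omega> \<partial>M) \<in> range ((*v) (var_matrix M Y))"
    from subspace_add[OF sub this mean] have "Y \<omega> \<in> range ((*v) (var_matrix M Y))"
      by (simp only: diff_add_cancel)
    then show "A *v Y \<omega> = (cov_matrix M X Y ** moore_penrose_inverse (var_matrix M Y)) *v Y \<omega>"
      by (rule linear_cond_exp_eq_gain_on_range[OF A])
  qed
qed

lemma cond_exp_given_gain:
  assumes A: "cond_exp_given M X Y (\<lambda>y. A *v y)"
    and mean: "(\<integral>\<omega>. X \<omega> \<partial>M) \<in> range ((*v) (var_matrix M Y))"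
  shows "cond_exp_given M X Y
    (\<lambda>y. (cov_matrix M X Y ** moore_penrose_inverse (var_matrix M Y)) *v y)"
  unfolding cond_exp_given_def
proof (intro conjI allI borel_measurable_matrix_vector_mult)
  fix i
  let ?K = "cov_matrix M X Y ** moore_penrose_inverse (var_matrix M Y)"
  have "AE \<omega> in M. real_cond_exp M (vimage_algebra (space M) Y borel) (\<lambda>\<omega>. X \<omega> $ i) \<omega> = (A *v Y \<omega>) $ i"
    using A by (simp add: cond_exp_given_def)
  with linear_cond_exp_AE_eq_gain[OF assms]
  show "AE \<omega> in M. real_cond_exp M (vimage_algebra (space M) Y borel) (\<lambda>\<omega>. X \<omega> $ i) \<omega> = (?K *v Y \<omega>) $ i"
    by eventually_elim simp
qed

end

theorem theorem4p1:
  fixes M :: "'a measure" and X eps Y :: "'a \<Rightarrow> real^'n" and r :: real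
    and Q :: "(real^'n) measure" and M0 :: "real^'n^'n"
  assumes "prob_space M"
    and "prob_space.indep_var M borel X borel eps"
    and "integrable M (\<lambda>\<omega>. (norm (X \<omega>))\<^sup>2)"
    and "integrable M (\<lambda>\<omega>. (norm (eps \<omega>))\<^sup>2)"
    and "(\<integral>\<omega>. eps \<omega> \<partial>M) = 0"
    and "Y = (\<lambda>\<omega>. X \<omega> + eps \<omega>)"
    and "Q = distr M borel Y"
    and "0 < r" and "r < 1"
    and "M0 = cov_matrix M X Y ** moore_penrose_inverse (var_matrix M Y)"
  shows
    "(\<exists>m. cond_exp_given M X Y m) \<and>
     (\<forall>m. cond_exp_given M X Y m \<longrightarrow>
        (\<not> (AE \<omega> in M. eps \<omega> = 0) \<longrightarrow>
           (\<exists>\<rho>>0. emeasure (least_favorable Q m r \<rho>) UNIV = 1)) \<and>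
        (\<forall>\<rho>>0. emeasure (least_favorable Q m r \<rho>) UNIV = 1 \<longrightarrow>
           io_saddle_point M X eps r (rls_io m \<rho>) (least_favorable Q m r \<rho>))) \<and>
     (\<forall>A. cond_exp_given M X Y (\<lambda>y. A *v y) \<longrightarrow>
        (\<forall>v \<in> range (\<lambda>z. var_matrix M Y *v z). A *v v = M0 *v v) \<and>
        (invertible (var_matrix M Y) \<longrightarrow> A = M0) \<and>
        ((\<integral>\<omega>. X \<omega> \<partial>M) \<in> range (\<lambda>z. var_matrix M Y *v z) \<longrightarrow>
           (AE \<omega> in M. A *v Y \<omega> = M0 *v Y \<omega>) \<and>
           cond_exp_given M X Y (\<lambda>y. M0 *v y) \<and>
           (\<forall>m \<rho>. cond_exp_given M X Y m \<and> \<rho> > 0 \<longrightarrow>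
              (AE y in Q. rls_io m \<rho> y = y - clip_factor \<rho> (y - M0 *v y) *\<^sub>R (y - M0 *v y))) \<and>
           (\<forall>\<rho>>0. emeasure (least_favorable Q (\<lambda>y. M0 *v y) r \<rho>) UNIV = 1 \<longrightarrow>
              io_saddle_point M X eps r
                (\<lambda>y. y - clip_factor \<rho> (y - M0 *v y) *\<^sub>R (y - M0 *v y))
                (least_favorable Q (\<lambda>y. M0 *v y) r \<rho>)))) \<and>
     M0 = var_matrix M X ** moore_penrose_inverse (var_matrix M X + var_matrix M eps)"
proof -
  have ideal: "ideal_model M X eps"
    using assms by (simp add: ideal_model_def ideal_model_axioms_def)
  have conditioned: "conditioned_ideal_model M X eps m" if "cond_exp_given M X Y m" for m
    using that ideal assms(6) by (simp add: conditioned_ideal_model_def conditioned_ideal_model_axioms_def)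
  have saddle: "io_saddle_point M X eps r (rls_io m \<rho>) (least_favorable Q m r \<rho>)"
    if "cond_exp_given M X Y m" "\<rho> > 0" "emeasure (least_favorable Q m r \<rho>) UNIV = 1" for m \<rho>
    using conditioned_ideal_model.io_saddle_point_least_favorable[OF conditioned[OF that(1)]]
      that(2,3) assms(6-9) by simp
  have height: "\<exists>\<rho>>0. emeasure (least_favorable Q m r \<rho>) UNIV = 1"
    if "cond_exp_given M X Y m" "\<not> (AE \<omega> in M. eps \<omega> = 0)" for m
    using conditioned_ideal_model.clipping_height_exists[OF conditioned[OF that(1)]]
      that(2) assms(6-9) by simp
  have Y [measurable]: "Y \<in> borel_measurable M"
    using ideal_model.X_measurable[OF ideal] ideal_model.eps_measurable[OF ideal] assms(6) by simp
  have part1: "\<exists>m. cond_exp_given M X Y m"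
    using ideal_model.cond_exp_given_exists[OF ideal] assms(6) by simp
  have linear: "(\<forall>v \<in> range (\<lambda>z. var_matrix M Y *v z). A *v v = M0 *v v) \<and>
        (invertible (var_matrix M Y) \<longrightarrow> A = M0) \<and>
        ((\<integral>\<omega>. X \<omega> \<partial>M) \<in> range (\<lambda>z. var_matrix M Y *v z) \<longrightarrow>
           (AE \<omega> in M. A *v Y \<omega> = M0 *v Y \<omega>) \<and>
           cond_exp_given M X Y (\<lambda>y. M0 *v y) \<and>
           (\<forall>m \<rho>. cond_exp_given M X Y m \<and> \<rho> > 0 \<longrightarrow>
              (AE y in Q. rls_io m \<rho> y = y - clip_factor \<rho> (y - M0 *v y) *\<^sub>R (y - M0 *v y))) \<and>
           (\<forall>\<rho>>0. emeasure (least_favorable Q (\<lambda>y. M0 *v y) r \<rho>) UNIV = 1 \<longrightarrow>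
              io_saddle_point M X eps r
                (\<lambda>y. y - clip_factor \<rho> (y - M0 *v y) *\<^sub>R (y - M0 *v y))
                (least_favorable Q (\<lambda>y. M0 *v y) r \<rho>)))"
    if A: "cond_exp_given M X Y (\<lambda>y. A *v y)" for A
  proof (intro conjI impI)
    show "\<forall>v \<in> range (\<lambda>z. var_matrix M Y *v z). A *v v = M0 *v v"
      using ideal_model.linear_cond_exp_eq_gain_on_range[OF ideal] A assms(6,10) by simp
    show "A = M0" if "invertible (var_matrix M Y)"
      using ideal_model.linear_cond_exp_eq_gain[OF ideal] A that assms(6,10) by simp
  next
    assume mean: "(\<integral>\<omega>. X \<omega> \<partial>M) \<in> range (\<lambda>z. var_matrix M Y *v z)"
    show "AE \<omega> in M. A *v Y \<omega> = M0 *v Y \<omega>"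
      using ideal_model.linear_cond_exp_AE_eq_gain[OF ideal] A mean assms(6,10) by simp
    show gain: "cond_exp_given M X Y (\<lambda>y. M0 *v y)"
      using ideal_model.cond_exp_given_gain[OF ideal] A mean assms(6,10) by simp
    show "\<forall>m \<rho>. cond_exp_given M X Y m \<and> \<rho> > 0 \<longrightarrow>
        (AE y in Q. rls_io m \<rho> y = y - clip_factor \<rho> (y - M0 *v y) *\<^sub>R (y - M0 *v y))"
    proof (intro allI impI)
      fix m and \<rho> :: real
      assume m: "cond_exp_given M X Y m \<and> \<rho> > 0"
      then have [measurable]: "m \<in> borel_measurable borel" by (simp add: cond_exp_given_def)
      have "AE \<omega> in M. m (Y \<omega>) = M0 *v Y \<omega>" using m gain by (intro cond_exp_given_AE_eq) auto
      then have "AE y in Q. m y = M0 *v y" unfolding assms(7) by (subst AE_distr_iff) simp_all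
      then show "AE y in Q. rls_io m \<rho> y = y - clip_factor \<rho> (y - M0 *v y) *\<^sub>R (y - M0 *v y)"
        by eventually_elim (simp add: rls_io_def)
    qed
    show "\<forall>\<rho>>0. emeasure (least_favorable Q (\<lambda>y. M0 *v y) r \<rho>) UNIV = 1 \<longrightarrow>
        io_saddle_point M X eps r (\<lambda>y. y - clip_factor \<rho> (y - M0 *v y) *\<^sub>R (y - M0 *v y))
          (least_favorable Q (\<lambda>y. M0 *v y) r \<rho>)"
      using saddle[OF gain] by (simp add: rls_io_def[abs_def])
  qed
  have "M0 = var_matrix M X ** moore_penrose_inverse (var_matrix M X + var_matrix M eps)"
    using ideal_model.cov_matrix_X_Y[OF ideal] ideal_model.var_matrix_Y[OF ideal] assms(6,10) by simp
  with part1 saddle height linear show ?thesis by blast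
qed

end
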